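(* Let $\mathsf H$ be a quaternionic Hilbert space, $\imath\in\mathbb S$, let $T:D(T)\to\mathsf H$ be a closed normal operator with dense domain and let $\mathcal Q=(Q,\mathcal L)$ be an iqPVM over $\mathbb C_\imath^+$ in $\mathsf H$ satisfying $T=\int_{\mathbb C_\imath^+}\mathit{id}\,d\mathcal Q$, where $\mathit{id}:\mathbb C_\imath^+\hookrightarrow\mathbb H$ is the inclusion. Write $L_q=\mathcal L(q)$. Then $$\sigma_{\mathcal L}(T)=\sigma_S(T)\cap\mathbb C_\imath^+$$ and $$\mathsf R_q(T)=\int_{\mathbb C_\imath^+}(z-q)^{-1}\,d\mathcal Q(z)\qquad\text{if }q\in\rho_{\mathcal L}(T).$$ Moreover, if $q\in\mathbb C_\imath^+$: (i) $q$ is a left eigenvalue of $T$ with respect to $\mathcal L$ (i.e. $\mathrm{Ker}(T-L_q)\ne\{0\}$) if and only if it is a right eigenvalue of $T$ (i.e. $Tu=uq$ for some $u\in D(T)\setminus\{0\}$). If $u\in D(T)\setminus\{0\}$ satisfies $Tu=uq$, then also $Tu=L_qu$. (ii) If $\mathrm{Ker}(T-L_q)=\{0\}$, then $\mathrm{Ran}(T-L_q)$ is dense in $\mathsf H$. (iii) $q$ belongs to the left continuous spectrum of $T$ with respect to $\mathcal L$ (i.e. $\mathrm{Ker}(T-L_q)=\{0\}$ and $\mathsf R_q(T)$ is not bounded) if and only if $q$ belongs to the spherical continuous spectrum $\sigma_{cS}(T)$.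
   Context: $\mathbb H$ denotes the quaternions, $\mathbb S=\{q\in\mathbb H: q^2=-1\}$. For $\imath\in\mathbb S$: $\mathbb C_\imath^+=\{\alpha+\imath\beta:\alpha,\beta\in\mathbb R,\ \beta\ge0\}$, with Euclidean topology and Borel $\sigma$-algebra $\mathscr B(\mathbb C_\imath^+)$. A quaternionic Hilbert space $\mathsf H$ is a non-zero right $\mathbb H$-module with an additive $\mathbb H$-valued product satisfying $\langle u|vp+wq\rangle=\langle u|v\rangle p+\langle u|w\rangle q$, $\langle u|v\rangle=\overline{\langle v|u\rangle}$, $\langle u|u\rangle\ge0$, such that $\|u\|=\sqrt{\langle u|u\rangle}$ is a complete norm. An operator $T:D(T)\to\mathsf H$ is a right $\mathbb H$-linear map on a right $\mathbb H$-linear subspace; sums and compositions have natural domains; $T$ is normal if $TT^*=T^*T$. $\mathfrak B(\mathsf H)$ is the set of bounded operators $\mathsf H\to\mathsf H$. Left scalar multiplication of $\mathsf H$: a map $\mathcal L:\mathbb H\to\mathfrak B(\mathsf H)$, $\mathcal L(q)=L_q$, of the form $L_qu=\sum_{z\in N}zq\langle z|u\rangle$ for some Hilbert (orthonormal, total) basis $N$. qPVM over $\mathbb C_\imath^+$ in $\mathsf H$: a map $Q:\mathscr B(\mathbb C_\imath^+)\to\mathfrak B(\mathsf H)$ with $Q(E)\ge0$, $Q(\mathbb C_\imath^+)=I$, $Q(E)Q(E')=Q(E\cap E')$, and $\sum_nQ(E_n)u=Q(\bigcup_nE_n)u$ for all $u$ and all countable families of pairwise disjoint Borel sets. An iqPVM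 is a pair $\mathcal Q=(Q,\mathcal L)$ with $Q$ a qPVM and $\mathcal L$ a left scalar multiplication with $Q(E)L_q=L_qQ(E)$ for all $E,q$. Integral: for simple $s=\sum_\ell S_\ell\chi_{E_\ell}$ ($S_\ell\in\mathbb H$, $E_\ell$ disjoint Borel), $\int s\,d\mathcal Q=\sum_\ell L_{S_\ell}Q(E_\ell)$; for bounded Borel $\varphi:\mathbb C_\imath^+\to\mathbb H$, $\int\varphi\,d\mathcal Q\in\mathfrak B(\mathsf H)$ is the norm limit of $\int s_n\,d\mathcal Q$, $s_n$ simple, $s_n\to\varphi$ uniformly. For arbitrary Borel $f:\mathbb C_\imath^+\to\mathbb H$, $\int f\,d\mathcal Q$ is the operator with domain $D_f=\{u\in\mathsf H:\int|f|^2d\mu_u<\infty\}$, $\mu_u(E)=\langle u|Q(E)u\rangle$, given by $\int f\,d\mathcal Q\,u=\lim_n\int f_n\,d\mathcal Q\,u$, with $f_n=f$ where $|f|\le n$ and $f_n=0$ elsewhere. The integrand $(z-q)^{-1}$ is given the value $0$ at $z=q$. Left spectrum: $\rho_{\mathcal L}(T)$ is the set of $q\in\mathbb H$ such that $T-L_q:D(T)\to\mathsf H$ is bijective and $\mathsf R_q(T):=(T-L_q)^{-1}$ is bounded; $\sigma_{\mathcal L}(T)=\mathbb H\setminus\rho_{\mathcal L}(T)$. In (iii), $\mathsf R_q(T)$ denotes $(T-L_q)^{-1}:\mathrm{Ran}(T-L_q)\to D(T)$. Spherical spectrum: for $q\in\mathbb H$, $\Delta_q(T)=T^2-T(2\mathrm{Re}(q))+I|q|^2$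 on $D(T^2)$. $q$ lies in the spherical resolvent set iff $\mathrm{Ker}\,\Delta_q(T)=\{0\}$, $\mathrm{Ran}\,\Delta_q(T)$ is dense and $\Delta_q(T)^{-1}:\mathrm{Ran}\,\Delta_q(T)\to D(T^2)$ is bounded; $\sigma_S(T)$ is its complement in $\mathbb H$. $\sigma_{cS}(T)$ is the set of $q$ with $\mathrm{Ker}\,\Delta_q(T)=\{0\}$, $\mathrm{Ran}\,\Delta_q(T)$ dense and $\Delta_q(T)^{-1}$ not bounded. *)

theory Defs
  imports "HOL-Analysis.Analysis"
begin

section \<open>Quaternions\<close>

datatype quat = Quat (qRe: real) (qI: real) (qJ: real) (qK: real)

lemma quat_eq_iff: "p = q \<longleftrightarrow> qRe p = qRe q \<and> qI p = qI q \<and> qJ p = qJ q \<and> qK p = qK q"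
  by (cases p; cases q) auto

instantiation quat :: real_algebra_1
begin

definition "0 = Quat 0 0 0 0"
definition "1 = Quat 1 0 0 0"
definition "p + q = Quat (qRe p + qRe q) (qI p + qI q) (qJ p + qJ q) (qK p + qK q)"
definition "p - q = Quat (qRe p - qRe q) (qI p - qI q) (qJ p - qJ q) (qK p - qK q)"
definition "- q = Quat (- qRe q) (- qI q) (- qJ q) (- qK q)"
definition "scaleR r q = Quat (r * qRe q) (r * qI q) (r * qJ q) (r * qK q)"
definition "p * q = Quat
  (qRe p * qRe q - qI p * qI q - qJ p * qJ q - qK p * qK q)
  (qRe p * qI q + qI p * qRe q + qJ p * qK q - qK p * qJ q)
  (qRe p * qJ q - qI p * qK q + qJ p * qRe q + qK p * qI q)
  (qRe p * qK q + qI p * qJ q - qJ p * qI q + qK p * qRe q)"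

lemmas quat_arith_defs = zero_quat_def one_quat_def plus_quat_def minus_quat_def
  uminus_quat_def scaleR_quat_def times_quat_def

instance
  by standard (auto simp: quat_arith_defs algebra_simps)

end

lemma quat_sel_simps [simp]:
  "qRe 0 = 0" "qI 0 = 0" "qJ 0 = 0" "qK 0 = 0"
  "qRe 1 = 1" "qI 1 = 0" "qJ 1 = 0" "qK 1 = 0"
  "qRe (p + q) = qRe p + qRe q" "qI (p + q) = qI p + qI q"
  "qJ (p + q) = qJ p + qJ q" "qK (p + q) = qK p + qK q"
  "qRe (p - q) = qRe p - qRe q" "qI (p - q) = qI p - qI q"
  "qJ (p - q) = qJ p - qJ q" "qK (p - q) = qK p - qK q"
  "qRe (- p) = - qRe p" "qI (- p) = - qI p" "qJ (- p) = - qJ p" "qK (- p) = - qK p"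
  "qRe (r *\<^sub>R p) = r * qRe p" "qI (r *\<^sub>R p) = r * qI p"
  "qJ (r *\<^sub>R p) = r * qJ p" "qK (r *\<^sub>R p) = r * qK p"
  by (simp_all add: quat_arith_defs)

lemma quat_mult_sel:
  "qRe (p * q) = qRe p * qRe q - qI p * qI q - qJ p * qJ q - qK p * qK q"
  "qI (p * q) = qRe p * qI q + qI p * qRe q + qJ p * qK q - qK p * qJ q"
  "qJ (p * q) = qRe p * qJ q - qI p * qK q + qJ p * qRe q + qK p * qI q"
  "qK (p * q) = qRe p * qK q + qI p * qJ q - qJ p * qI q + qK p * qRe q"
  by (simp_all add: times_quat_def)

definition qcnj :: "quat \<Rightarrow> quat" where
  "qcnj q = Quat (qRe q) (- qI q) (- qJ q) (- qK q)"

lemma qcnj_sel [simp]: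
  "qRe (qcnj q) = qRe q" "qI (qcnj q) = - qI q" "qJ (qcnj q) = - qJ q" "qK (qcnj q) = - qK q"
  by (simp_all add: qcnj_def)

instantiation quat :: real_inner
begin

definition "inner p q = qRe p * qRe q + qI p * qI q + qJ p * qJ q + qK p * qK q" for p q :: quat
definition "norm q = sqrt (inner q q)" for q :: quat
definition "sgn q = q /\<^sub>R norm q" for q :: quat
definition "dist p q = norm (p - q)" for p q :: quat
definition "(uniformity :: (quat \<times> quat) filter) = (INF e\<in>{0<..}. principal {(x, y). dist x y < e})"
definition "open (U :: quat set) \<longleftrightarrow> (\<forall>x\<in>U. eventually (\<lambda>(x', y). x' = x \<longrightarrow> y \<in> U) uniformity)"

instance
proof
  fix x y z :: quat and r :: real
  show "inner x y = inner y x" "inner (x + y) z = inner x z + inner y z"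
    "inner (r *\<^sub>R x) y = r * inner x y" "0 \<le> inner x x"
    by (simp_all add: inner_quat_def algebra_simps)
  have "inner x x = (qRe x)\<^sup>2 + (qI x)\<^sup>2 + (qJ x)\<^sup>2 + (qK x)\<^sup>2"
    by (simp add: inner_quat_def power2_eq_square)
  then show "inner x x = 0 \<longleftrightarrow> x = 0"
    by (simp add: quat_eq_iff add_nonneg_eq_0_iff)
qed (rule sgn_quat_def dist_quat_def uniformity_quat_def open_quat_def norm_quat_def)+

end

instantiation quat :: euclidean_space
begin

definition "Basis = {Quat 1 0 0 0, Quat 0 1 0 0, Quat 0 0 1 0, Quat 0 0 0 1}"

instance
proof
  fix u v x :: quat
  show "u \<in> Basis \<Longrightarrow> v \<in> Basis \<Longrightarrow> inner u v = (if u = v then 1 else 0)"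
    unfolding Basis_quat_def by (elim insertE emptyE) (simp_all add: inner_quat_def)
  show "(\<forall>u\<in>Basis. inner x u = 0) \<longleftrightarrow> x = 0"
    unfolding Basis_quat_def quat_eq_iff[of x] by (simp add: inner_quat_def)
qed (simp_all add: Basis_quat_def)

end

instantiation quat :: real_normed_div_algebra
begin

definition "inverse q = qcnj q /\<^sub>R (norm q)\<^sup>2" for q :: quat
definition "p div q = p * inverse q" for p q :: quat

lemma norm_quat_sq: "(norm q)\<^sup>2 = (qRe q)\<^sup>2 + (qI q)\<^sup>2 + (qJ q)\<^sup>2 + (qK q)\<^sup>2" for q :: quat
  by (simp add: norm_quat_def inner_quat_def power2_eq_square)

lemma qcnj_mult: "qcnj (p * q) = qcnj q * qcnj p"
  by (simp add: quat_eq_iff quat_mult_sel)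

lemma qcnj_mult_self: "qcnj q * q = (norm q)\<^sup>2 *\<^sub>R 1" "q * qcnj q = (norm q)\<^sup>2 *\<^sub>R 1"
  unfolding norm_quat_sq by (simp_all add: quat_eq_iff quat_mult_sel power2_eq_square)

instance
proof
  fix x y :: quat
  show "x \<noteq> 0 \<Longrightarrow> inverse x * x = 1" "x \<noteq> 0 \<Longrightarrow> x * inverse x = 1"
    by (simp_all add: inverse_quat_def qcnj_mult_self)
  show "x div y = x * inverse y" by (rule divide_quat_def)
  show "inverse (0 :: quat) = 0" by (simp add: inverse_quat_def quat_eq_iff)
  have "(norm (x * y))\<^sup>2 *\<^sub>R (1 :: quat) = x * (y * qcnj y) * qcnj x"
    by (simp only: qcnj_mult_self(2)[symmetric] qcnj_mult mult.assoc)
  also have "\<dots> = ((norm x)\<^sup>2 * (norm y)\<^sup>2) *\<^sub>R 1"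
    by (simp add: qcnj_mult_self mult.commute)
  finally have "(norm (x * y))\<^sup>2 = (norm x * norm y)\<^sup>2"
    by (simp add: power_mult_distrib)
  then show "norm (x * y) = norm x * norm y"
    by (metis norm_ge_zero mult_nonneg_nonneg power2_eq_imp_eq)
qed

end

definition imag_units :: "quat set" where
  "imag_units = {q. q\<^sup>2 = -1}"

definition half_plane :: "quat \<Rightarrow> quat set" where
  "half_plane \<iota> = {of_real \<alpha> + \<iota> * of_real \<beta> | \<alpha> \<beta>. \<beta> \<ge> 0}"

definition qnonneg :: "quat \<Rightarrow> bool" where
  "qnonneg q \<longleftrightarrow> q \<in> \<real> \<and> qRe q \<ge> 0"


section \<open>Quaternionic Hilbert spaces\<close>

text \<open>Real scalar multiplication of the underlying Banach space is not extra structure: by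
  \<open>scaleR_eq_scaleQ\<close> it is the restriction of the right quaternionic one.\<close>

class quat_hilbert = banach +
  fixes scaleQ :: "'a \<Rightarrow> quat \<Rightarrow> 'a" (infixl "*\<^sub>Q" 75)
    and qinner :: "'a \<Rightarrow> 'a \<Rightarrow> quat"
  assumes scaleQ_add_left: "(u + v) *\<^sub>Q p = u *\<^sub>Q p + v *\<^sub>Q p"
    and scaleQ_add_right: "u *\<^sub>Q (p + q) = u *\<^sub>Q p + u *\<^sub>Q q"
    and scaleQ_scaleQ: "(u *\<^sub>Q p) *\<^sub>Q q = u *\<^sub>Q (p * q)"
    and scaleQ_one: "u *\<^sub>Q 1 = u"
    and scaleR_eq_scaleQ: "r *\<^sub>R u = u *\<^sub>Q of_real r"
    and nontrivial: "\<exists>u. u \<noteq> 0"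
    and qinner_right: "qinner u (v *\<^sub>Q p + w *\<^sub>Q q) = qinner u v * p + qinner u w * q"
    and qinner_commute: "qinner u v = qcnj (qinner v u)"
    and qinner_self_nonneg: "qnonneg (qinner u u)"
    and norm_eq_sqrt_qinner: "norm u = sqrt (qRe (qinner u u))"

instantiation quat :: quat_hilbert
begin

definition "u *\<^sub>Q p = u * p" for u p :: quat
definition "qinner u v = qcnj u * v" for u v :: quat

instance
proof
  fix u v w p q :: quat and r :: real
  show "(u + v) *\<^sub>Q p = u *\<^sub>Q p + v *\<^sub>Q p" "u *\<^sub>Q (p + q) = u *\<^sub>Q p + u *\<^sub>Q q"
    "(u *\<^sub>Q p) *\<^sub>Q q = u *\<^sub>Q (p * q)" "u *\<^sub>Q 1 = u" "r *\<^sub>R u = u *\<^sub>Q of_real r"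
    "qinner u (v *\<^sub>Q p + w *\<^sub>Q q) = qinner u v * p + qinner u w * q"
    by (simp_all add: scaleQ_quat_def qinner_quat_def algebra_simps of_real_def)
  show "\<exists>u :: quat. u \<noteq> 0" by (rule exI[of _ 1]) simp
  show "qinner u v = qcnj (qinner v u)"
    by (simp add: qinner_quat_def quat_eq_iff quat_mult_sel)
  show "qnonneg (qinner u u)"
    by (simp add: qinner_quat_def qcnj_mult_self qnonneg_def flip: of_real_def)
      (simp add: of_real_def)
  show "norm u = sqrt (qRe (qinner u u))"
    by (simp add: qinner_quat_def qcnj_mult_self)
qed

end

definition qsubspace :: "'h::quat_hilbert set \<Rightarrow> bool" where
  "qsubspace S \<longleftrightarrow> 0 \<in> S \<and> (\<forall>u\<in>S. \<forall>v\<in>S. \<forall>p q. u *\<^sub>Q p + v *\<^sub>Q q \<in> S)"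

definition hilbert_basis :: "'h::quat_hilbert set \<Rightarrow> bool" where
  "hilbert_basis N \<longleftrightarrow>
     (\<forall>z\<in>N. \<forall>w\<in>N. qinner z w = (if z = w then 1 else 0)) \<and> closure (qsubspace hull N) = UNIV"


section \<open>Operators\<close>

text \<open>An operator with domain is a partial map: \<open>dom T\<close> is its domain, equality of operators
  includes equality of domains, \<open>S \<circ>\<^sub>m T\<close> is composition on its natural domain, and
  \<open>Some\<close> is the identity operator.\<close>

type_synonym 'h qop = "'h \<rightharpoonup> 'h"

definition qlinear_op :: "'h::quat_hilbert qop \<Rightarrow> bool" where
  "qlinear_op T \<longleftrightarrow> qsubspace (dom T) \<and>
     (\<forall>u u' v v' p q. T u = Some u' \<longrightarrow> T v = Some v' \<longrightarrow>
        T (u *\<^sub>Q p + v *\<^sub>Q q) = Some (u' *\<^sub>Q p + v' *\<^sub>Q q))"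

definition op_of :: "('h \<Rightarrow>\<^sub>L 'h) \<Rightarrow> 'h::quat_hilbert qop" where
  "op_of A = (\<lambda>u. Some (blinfun_apply A u))"

definition op_add :: "'h qop \<Rightarrow> 'h qop \<Rightarrow> 'h::quat_hilbert qop" where
  "op_add S T = (\<lambda>u. case (S u, T u) of (Some v, Some w) \<Rightarrow> Some (v + w) | _ \<Rightarrow> None)"

definition op_scaleR :: "real \<Rightarrow> 'h qop \<Rightarrow> 'h::quat_hilbert qop" where
  "op_scaleR r T = (\<lambda>u. map_option (\<lambda>v. r *\<^sub>R v) (T u))"

definition op_diff :: "'h qop \<Rightarrow> 'h qop \<Rightarrow> 'h::quat_hilbert qop" where
  "op_diff S T = op_add S (op_scaleR (-1) T)"

definition op_ker :: "'h qop \<Rightarrow> 'h::quat_hilbert set" where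
  "op_ker T = {u. T u = Some 0}"

text \<open>Only meaningful for injective operators.\<close>
definition op_inverse :: "'h qop \<Rightarrow> 'h::quat_hilbert qop" where
  "op_inverse T = (\<lambda>v. if v \<in> ran T then Some (THE u. T u = Some v) else None)"

definition op_bounded :: "'h::quat_hilbert qop \<Rightarrow> bool" where
  "op_bounded T \<longleftrightarrow> (\<exists>K. \<forall>u v. T u = Some v \<longrightarrow> norm v \<le> K * norm u)"

definition op_closed :: "'h::quat_hilbert qop \<Rightarrow> bool" where
  "op_closed T \<longleftrightarrow> closed (Map.graph T)"

definition densely_defined :: "'h::quat_hilbert qop \<Rightarrow> bool" where
  "densely_defined T \<longleftrightarrow> closure (dom T) = UNIV"

text \<open>Only meaningful for densely defined operators, where the vector \<open>v\<close> below is unique.\<close>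
definition op_adjoint :: "'h qop \<Rightarrow> 'h::quat_hilbert qop" where
  "op_adjoint T = (\<lambda>u.
     let P = (\<lambda>v. \<forall>w w'. T w = Some w' \<longrightarrow> qinner u w' = qinner v w)
     in if \<exists>v. P v then Some (THE v. P v) else None)"

definition op_normal :: "'h::quat_hilbert qop \<Rightarrow> bool" where
  "op_normal T \<longleftrightarrow> T \<circ>\<^sub>m op_adjoint T = op_adjoint T \<circ>\<^sub>m T"

definition qbounded_ops :: "('h::quat_hilbert \<Rightarrow>\<^sub>L 'h) set" where
  "qbounded_ops = {A. \<forall>u q. blinfun_apply A (u *\<^sub>Q q) = blinfun_apply A u *\<^sub>Q q}"

definition qpositive :: "('h::quat_hilbert \<Rightarrow>\<^sub>L 'h) \<Rightarrow> bool" where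
  "qpositive A \<longleftrightarrow> (\<forall>u. qnonneg (qinner u (blinfun_apply A u)))"


section \<open>Intertwining quaternionic projection-valued measures\<close>

definition left_scalar_mult :: "(quat \<Rightarrow> 'h::quat_hilbert \<Rightarrow>\<^sub>L 'h) \<Rightarrow> bool" where
  "left_scalar_mult L \<longleftrightarrow> (\<forall>q. L q \<in> qbounded_ops) \<and>
     (\<exists>N. hilbert_basis N \<and>
        (\<forall>q u. ((\<lambda>z. z *\<^sub>Q q *\<^sub>Q qinner z u) has_sum blinfun_apply (L q) u) N))"

abbreviation half_plane_borel :: "quat \<Rightarrow> quat measure" where
  "half_plane_borel \<iota> \<equiv> restrict_space borel (half_plane \<iota>)"

definition qpvm :: "quat \<Rightarrow> (quat set \<Rightarrow> 'h::quat_hilbert \<Rightarrow>\<^sub>L 'h) \<Rightarrow> bool" where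
  "qpvm \<iota> Q \<longleftrightarrow>
     (\<forall>E\<in>sets (half_plane_borel \<iota>). Q E \<in> qbounded_ops \<and> qpositive (Q E)) \<and>
     Q (half_plane \<iota>) = id_blinfun \<and>
     (\<forall>E\<in>sets (half_plane_borel \<iota>). \<forall>E'\<in>sets (half_plane_borel \<iota>). Q E o\<^sub>L Q E' = Q (E \<inter> E')) \<and>
     (\<forall>E :: nat \<Rightarrow> quat set. \<forall>u. range E \<subseteq> sets (half_plane_borel \<iota>) \<longrightarrow> disjoint_family E \<longrightarrow>
        (\<lambda>n. blinfun_apply (Q (E n)) u) sums blinfun_apply (Q (\<Union>n. E n)) u)"

definition iqpvm ::
  "quat \<Rightarrow> (quat set \<Rightarrow> 'h::quat_hilbert \<Rightarrow>\<^sub>L 'h) \<Rightarrow> (quat \<Rightarrow> 'h \<Rightarrow>\<^sub>L 'h) \<Rightarrow> bool" where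
  "iqpvm \<iota> Q L \<longleftrightarrow> qpvm \<iota> Q \<and> left_scalar_mult L \<and>
     (\<forall>E\<in>sets (half_plane_borel \<iota>). \<forall>q. Q E o\<^sub>L L q = L q o\<^sub>L Q E)"

text \<open>The integral of a simple function, through its canonical representation by level sets.\<close>
definition iq_integral_simple ::
  "quat \<Rightarrow> (quat set \<Rightarrow> 'h::quat_hilbert \<Rightarrow>\<^sub>L 'h) \<Rightarrow> (quat \<Rightarrow> 'h \<Rightarrow>\<^sub>L 'h) \<Rightarrow> (quat \<Rightarrow> quat) \<Rightarrow> 'h \<Rightarrow>\<^sub>L 'h" where
  "iq_integral_simple \<iota> Q L s =
     (\<Sum>p\<in>s ` half_plane \<iota>. L p o\<^sub>L Q (s -` {p} \<inter> half_plane \<iota>))"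

text \<open>The integral of a bounded Borel function on the half plane.\<close>
definition iq_integral_bounded ::
  "quat \<Rightarrow> (quat set \<Rightarrow> 'h::quat_hilbert \<Rightarrow>\<^sub>L 'h) \<Rightarrow> (quat \<Rightarrow> 'h \<Rightarrow>\<^sub>L 'h) \<Rightarrow> (quat \<Rightarrow> quat) \<Rightarrow> 'h \<Rightarrow>\<^sub>L 'h" where
  "iq_integral_bounded \<iota> Q L \<phi> =
     (THE A. \<exists>s :: nat \<Rightarrow> quat \<Rightarrow> quat.
        (\<forall>n. simple_function (half_plane_borel \<iota>) (s n)) \<and>
        uniform_limit (half_plane \<iota>) s \<phi> sequentially \<and>
        (\<lambda>n. iq_integral_simple \<iota> Q L (s n)) \<longlonglongrightarrow> A)"

definition spectral_measure ::
  "quat \<Rightarrow> (quat set \<Rightarrow> 'h::quat_hilbert \<Rightarrow>\<^sub>L 'h) \<Rightarrow> 'h \<Rightarrow> quat measure" where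
  "spectral_measure \<iota> Q u = measure_of (half_plane \<iota>) (sets (half_plane_borel \<iota>))
     (\<lambda>E. ennreal (qRe (qinner u (blinfun_apply (Q E) u))))"

text \<open>The integral of an arbitrary Borel function on the half plane.\<close>
definition iq_integral ::
  "quat \<Rightarrow> (quat set \<Rightarrow> 'h::quat_hilbert \<Rightarrow>\<^sub>L 'h) \<Rightarrow> (quat \<Rightarrow> 'h \<Rightarrow>\<^sub>L 'h) \<Rightarrow> (quat \<Rightarrow> quat) \<Rightarrow> 'h qop" where
  "iq_integral \<iota> Q L f = (\<lambda>u.
     if (\<integral>\<^sup>+z. ennreal ((norm (f z))\<^sup>2) \<partial>spectral_measure \<iota> Q u) < \<infinity>
     then Some (lim (\<lambda>n. blinfun_apply
            (iq_integral_bounded \<iota> Q L (\<lambda>z. if norm (f z) \<le> real n then f z else 0)) u))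
     else None)"


section \<open>Spectra\<close>

definition left_resolvent :: "(quat \<Rightarrow> 'h::quat_hilbert \<Rightarrow>\<^sub>L 'h) \<Rightarrow> 'h qop \<Rightarrow> quat \<Rightarrow> 'h qop" where
  "left_resolvent L T q = op_inverse (op_diff T (op_of (L q)))"

definition left_resolvent_set :: "(quat \<Rightarrow> 'h::quat_hilbert \<Rightarrow>\<^sub>L 'h) \<Rightarrow> 'h qop \<Rightarrow> quat set" where
  "left_resolvent_set L T = {q.
     bij_betw (\<lambda>u. the (op_diff T (op_of (L q)) u)) (dom T) UNIV \<and>
     op_bounded (left_resolvent L T q)}"

definition left_spectrum :: "(quat \<Rightarrow> 'h::quat_hilbert \<Rightarrow>\<^sub>L 'h) \<Rightarrow> 'h qop \<Rightarrow> quat set" where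
  "left_spectrum L T = - left_resolvent_set L T"

definition left_eigenvalue :: "(quat \<Rightarrow> 'h::quat_hilbert \<Rightarrow>\<^sub>L 'h) \<Rightarrow> 'h qop \<Rightarrow> quat \<Rightarrow> bool" where
  "left_eigenvalue L T q \<longleftrightarrow> op_ker (op_diff T (op_of (L q))) \<noteq> {0}"

definition right_eigenvalue :: "'h::quat_hilbert qop \<Rightarrow> quat \<Rightarrow> bool" where
  "right_eigenvalue T q \<longleftrightarrow> (\<exists>u. u \<noteq> 0 \<and> T u = Some (u *\<^sub>Q q))"

definition left_continuous_spectrum :: "(quat \<Rightarrow> 'h::quat_hilbert \<Rightarrow>\<^sub>L 'h) \<Rightarrow> 'h qop \<Rightarrow> quat set" where
  "left_continuous_spectrum L T = {q.
     op_ker (op_diff T (op_of (L q))) = {0} \<and> \<not> op_bounded (left_resolvent L T q)}"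

definition op_Delta :: "quat \<Rightarrow> 'h qop \<Rightarrow> 'h::quat_hilbert qop" where
  "op_Delta q T =
     op_add (op_diff (T \<circ>\<^sub>m T) (op_scaleR (2 * qRe q) T)) (op_scaleR ((norm q)\<^sup>2) Some)"

definition spherical_resolvent_set :: "'h::quat_hilbert qop \<Rightarrow> quat set" where
  "spherical_resolvent_set T = {q.
     op_ker (op_Delta q T) = {0} \<and> closure (ran (op_Delta q T)) = UNIV \<and>
     op_bounded (op_inverse (op_Delta q T))}"

definition spherical_spectrum :: "'h::quat_hilbert qop \<Rightarrow> quat set" where
  "spherical_spectrum T = - spherical_resolvent_set T"

definition spherical_continuous_spectrum :: "'h::quat_hilbert qop \<Rightarrow> quat set" where
  "spherical_continuous_spectrum T = {q.
     op_ker (op_Delta q T) = {0} \<and> closure (ran (op_Delta q T)) = UNIV \<and>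
     \<not> op_bounded (op_inverse (op_Delta q T))}"

end

theory Submission
  imports Defs
begin

text \<open>Write \<open>\<mu>\<^sub>u(E) = \<parallel>Q(E)u\<parallel>\<^sup>2\<close>. The map \<open>f \<mapsto> (\<integral>f dQ) u\<close> is an isometry from \<open>L\<^sup>2(\<mu>\<^sub>u)\<close>,
  and \<open>\<mu>\<close> at \<open>(\<integral>f dQ) u\<close> is \<open>|f|\<^sup>2 \<mu>\<^sub>u\<close>, so the integral is additive and multiplicative with natural
  domains. Hence \<open>\<integral>f dQ\<close> is injective iff \<open>Q{f = 0} = 0\<close>; it then has dense range and inverse
  \<open>\<integral>1/f dQ\<close>, which is bounded iff \<open>Q{|f| < \<epsilon>} = 0\<close> for some \<open>\<epsilon> > 0\<close>. This is applied to \<open>T - L\<^sub>q\<close>,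
  with \<open>f = z - q\<close>, and to \<open>\<Delta>\<^sub>q(T)\<close>, with \<open>f = (z - q)(z - q\<^sup>*)\<close>, where \<open>q\<^sup>*\<close> is the conjugate of \<open>q\<close>.
  On the half plane \<open>|z - q| \<le> |z - q\<^sup>*|\<close>, so both functions have the same zeros and the same gap
  condition at \<open>q\<close>.\<close>

section \<open>Quaternionic Hilbert spaces\<close>

text \<open>Two kinds of scalar multiplication meet here: \<open>L q u\<close> need not equal
  \<open>u *\<^sub>Q q\<close>, while a right eigenvalue equation uses the latter. They are linked
  in two ways. On the basis behind \<open>L\<close> they agree, which yields the identities for
  \<open>L\<close>. And \<Delta>_q(T) has real coefficients, so it can be computed on a right
  eigenvector, as right multiplication by the polynomial at q, as well as by an integral.
  Quaternions do not commute, so products of integrands keep their order; the integral is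
  multiplicative because \<open>L (p * q) = L p o\<^sub>L L q\<close> and \<open>L\<close> commutes
  with \<open>Q\<close>. The half plane is what makes the two spectra comparable: its points commute
  with each other, and each sphere of conjugate quaternions meets it in one point. For q outside the
  half plane only the left spectrum is at issue: the half plane is closed, so |z - q| is bounded
  below on it.\<close>

lemma qcnj_simps [simp]:
  "qcnj 0 = 0" "qcnj 1 = 1" "qcnj (p + q) = qcnj p + qcnj q" "qcnj (p - q) = qcnj p - qcnj q"
  "qcnj (qcnj p) = p" "qcnj (r *\<^sub>R p) = r *\<^sub>R qcnj p"
  by (simp_all add: quat_eq_iff)

lemma norm_qcnj [simp]: "norm (qcnj q) = norm q"
  by (simp add: norm_quat_def inner_quat_def)

lemma qRe_of_real [simp]: "qRe (of_real r) = r"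
  by (simp add: of_real_def)

lemma qRe_le_norm: "\<bar>qRe q\<bar> \<le> norm q"
  by (rule power2_le_imp_le) (simp_all add: norm_quat_sq)

lemma scaleQ_0_right [simp]: "u *\<^sub>Q 0 = (0::'h::quat_hilbert)"
  using scaleR_eq_scaleQ[of 0 u] by simp

lemma scaleQ_0_left [simp]: "0 *\<^sub>Q p = (0::'h::quat_hilbert)"
  using scaleQ_add_left[of "0::'h" 0 p] by simp

lemma scaleQ_scaleR_right: "u *\<^sub>Q (r *\<^sub>R p) = r *\<^sub>R (u *\<^sub>Q p :: 'h::quat_hilbert)"
  unfolding scaleR_eq_scaleQ[of r "u *\<^sub>Q p"] scaleQ_scaleQ by (simp add: of_real_def)

lemma scaleQ_scaleR_left: "(r *\<^sub>R u) *\<^sub>Q p = r *\<^sub>R (u *\<^sub>Q p :: 'h::quat_hilbert)"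
  unfolding scaleQ_scaleR_right[symmetric] unfolding scaleR_eq_scaleQ[of r u] scaleQ_scaleQ
  by (simp add: of_real_def)

lemma scaleQ_diff_right: "u *\<^sub>Q (p - q) = u *\<^sub>Q p - (u *\<^sub>Q q :: 'h::quat_hilbert)"
  using scaleQ_add_right[of u "p - q" q] by (simp add: algebra_simps)

lemma qinner_add_right: "qinner u (v + w) = qinner u v + qinner u (w::'h::quat_hilbert)"
  using qinner_right[of u v 1 w 1] by (simp add: scaleQ_one)

lemma qinner_scaleQ_right: "qinner u (v *\<^sub>Q p) = qinner u (v::'h::quat_hilbert) * p"
  using qinner_right[of u v p v 0] by simp

lemma qinner_add_left: "qinner (v + w) u = qinner v u + qinner w (u::'h::quat_hilbert)"
  by (subst (1 2 3) qinner_commute) (simp add: qinner_add_right)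

lemma qinner_scaleQ_left: "qinner (v *\<^sub>Q p) u = qcnj p * qinner v (u::'h::quat_hilbert)"
  by (subst (1 2) qinner_commute) (simp add: qinner_scaleQ_right qcnj_mult)

lemma qinner_scaleR_right: "qinner u (r *\<^sub>R v) = r *\<^sub>R qinner u (v::'h::quat_hilbert)"
  unfolding scaleR_eq_scaleQ[of r v] by (simp add: qinner_scaleQ_right of_real_def)

lemma qinner_scaleR_left: "qinner (r *\<^sub>R v) u = r *\<^sub>R qinner v (u::'h::quat_hilbert)"
  by (subst (1 2) qinner_commute) (simp add: qinner_scaleR_right)

lemma qinner_0 [simp]: "qinner u 0 = 0" "qinner 0 u = (0::quat)" for u :: "'h::quat_hilbert"
  using qinner_scaleR_right[of u 0 0] qinner_scaleR_left[of 0 0 u] by simp_all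

lemma qRe_qinner_commute: "qRe (qinner u v) = qRe (qinner v (u::'h::quat_hilbert))"
  by (subst qinner_commute) simp

lemma qRe_qinner_self: "qRe (qinner u u) = (norm (u::'h::quat_hilbert))\<^sup>2"
  using qinner_self_nonneg[of u] by (simp add: norm_eq_sqrt_qinner qnonneg_def)

lemma qinner_self: "qinner u u = of_real ((norm (u::'h::quat_hilbert))\<^sup>2)"
proof -
  obtain r where "qinner u u = of_real r"
    using qinner_self_nonneg[of u] by (auto simp: qnonneg_def elim: Reals_cases)
  then show ?thesis
    using qRe_qinner_self[of u] by simp
qed

lemma norm_add_sq:
  "(norm (u + v))\<^sup>2 = (norm u)\<^sup>2 + 2 * qRe (qinner u v) + (norm (v::'h::quat_hilbert))\<^sup>2"
  unfolding qRe_qinner_self[symmetric] using qRe_qinner_commute[of u v]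
  by (simp add: qinner_add_left qinner_add_right)

lemma norm_scaleQ: "norm (u *\<^sub>Q p) = norm (u::'h::quat_hilbert) * norm p"
proof -
  have "(norm (u *\<^sub>Q p))\<^sup>2 = qRe (qinner (u *\<^sub>Q p) (u *\<^sub>Q p))"
    by (rule qRe_qinner_self[symmetric])
  also have "\<dots> = qRe (qcnj p * (of_real ((norm u)\<^sup>2) * p))"
    by (simp only: qinner_scaleQ_left qinner_scaleQ_right qinner_self[of u] mult.assoc)
  also have "\<dots> = (norm u)\<^sup>2 * (norm p)\<^sup>2"
    by (simp add: of_real_def qcnj_mult_self)
  finally show ?thesis
    by (metis norm_ge_zero mult_nonneg_nonneg power_mult_distrib power2_eq_imp_eq)
qed

text \<open>The usual order is reversed: the triangle inequality is already an axiom of the normed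
  space, and comparing its square with \<open>norm_add_sq\<close> gives Cauchy-Schwarz for the real
  part.\<close>

lemma qRe_qinner_le: "qRe (qinner u v) \<le> norm u * norm (v::'h::quat_hilbert)"
proof -
  have "(norm (u + v))\<^sup>2 \<le> (norm u + norm v)\<^sup>2"
    by (simp add: norm_triangle_ineq power_mono)
  then show ?thesis
    by (simp add: norm_add_sq power2_sum)
qed

lemma norm_qinner_le: "norm (qinner u v) \<le> norm u * norm (v::'h::quat_hilbert)"
proof (cases "qinner u v = 0")
  case False
  \<comment> \<open>Multiplying v by the conjugate of the product makes the product real, which
    reduces the claim to the bound on real parts.\<close>
  have "(norm (qinner u v))\<^sup>2 = qRe (qinner u (v *\<^sub>Q qcnj (qinner u v)))"
    by (simp add: qinner_scaleQ_right qcnj_mult_self)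
  also have "\<dots> \<le> norm u * norm v * norm (qinner u v)"
    using qRe_qinner_le[of u "v *\<^sub>Q qcnj (qinner u v)"] by (simp add: norm_scaleQ mult.assoc)
  finally show ?thesis
    using False by (simp add: power2_eq_square)
qed simp

lemma bounded_bilinear_qinner: "bounded_bilinear (qinner :: 'h::quat_hilbert \<Rightarrow> 'h \<Rightarrow> quat)"
  by (rule bounded_bilinear.intro)
    (auto simp: qinner_add_left qinner_add_right qinner_scaleR_left qinner_scaleR_right
      intro!: exI[of _ 1] norm_qinner_le)

lemma bounded_linear_qRe: "bounded_linear qRe"
  by (rule bounded_linear_intro[of _ 1]) (simp_all add: qRe_le_norm)

lemma continuous_on_qinner [continuous_intros]:
  "continuous_on S f \<Longrightarrow> continuous_on S g \<Longrightarrow>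
    continuous_on S (\<lambda>x. qinner (f x) (g x :: 'h::quat_hilbert))"
  by (rule bounded_bilinear.continuous_on[OF bounded_bilinear_qinner])

lemma qbounded_ops_scaleQ:
  "A \<in> qbounded_ops \<Longrightarrow> blinfun_apply A (u *\<^sub>Q q) = blinfun_apply A u *\<^sub>Q q"
  by (simp add: qbounded_ops_def)

text \<open>Totality as an induction rule: a condition that is right linear and closed under limits
  need only be checked on the basis.\<close>

lemma hilbert_basis_induct:
  assumes "hilbert_basis N" "qsubspace S" "closed S" "N \<subseteq> S"
  shows "u \<in> S"
proof -
  have "closure (qsubspace hull N) \<subseteq> S"
    using assms by (intro closure_minimal hull_minimal)
  then show ?thesis
    using assms(1) by (auto simp: hilbert_basis_def)
qed

lemma blinfun_eq_on_basis:
  assumes N: "hilbert_basis N" and AB: "A \<in> qbounded_ops" "B \<in> qbounded_ops"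
    and eq: "\<And>z. z \<in> N \<Longrightarrow> blinfun_apply A z = blinfun_apply B z"
  shows "A = B"
proof (rule blinfun_eqI)
  fix u
  have "u \<in> {u. blinfun_apply A u = blinfun_apply B u}"
    using N
  proof (rule hilbert_basis_induct)
    show "qsubspace {u. blinfun_apply A u = blinfun_apply B u}"
      using AB by (simp add: qsubspace_def blinfun.add_right qbounded_ops_scaleQ)
    show "closed {u. blinfun_apply A u = blinfun_apply B u}"
      by (intro closed_Collect_eq continuous_intros)
  qed (use eq in auto)
  then show "blinfun_apply A u = blinfun_apply B u" by simp
qed

section \<open>Left scalar multiplications\<close>

text \<open>By orthonormality a single term of the defining series survives at a basis vector. From
  here on this replaces the series; one basis serves all q.\<close>

lemma left_scalar_mult_basis:
  assumes "left_scalar_mult L"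
  obtains N where "hilbert_basis N" "\<And>z q. z \<in> N \<Longrightarrow> blinfun_apply (L q) z = z *\<^sub>Q q"
proof -
  from assms obtain N where N: "hilbert_basis N"
    and L: "\<And>q u. ((\<lambda>z. z *\<^sub>Q q *\<^sub>Q qinner z u) has_sum blinfun_apply (L q) u) N"
    unfolding left_scalar_mult_def by blast
  have "blinfun_apply (L q) z = z *\<^sub>Q q" if "z \<in> N" for z q
  proof -
    have "((\<lambda>w. w *\<^sub>Q q *\<^sub>Q qinner w z) has_sum (\<Sum>w\<in>{z}. w *\<^sub>Q q *\<^sub>Q qinner w z)) {z}"
      by (rule has_sum_finite) simp
    then have "((\<lambda>w. w *\<^sub>Q q *\<^sub>Q qinner w z) has_sum (z *\<^sub>Q q)) N"
      using N that by (subst has_sum_cong_neutral[where T = "{z}" and S = N])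
        (auto simp: hilbert_basis_def scaleQ_one)
    then show ?thesis
      using L[of q z] has_sum_unique by blast
  qed
  with N show thesis by (rule that)
qed

lemma left_scalar_mult_ops: "left_scalar_mult L \<Longrightarrow> L q \<in> qbounded_ops"
  by (simp add: left_scalar_mult_def)

text \<open>The last premise hides the basis: all that it grants about z is that every
  \<open>L p\<close> acts there as right multiplication, which is enough for the identities
  below.\<close>

lemma left_scalar_mult_eqI:
  assumes "left_scalar_mult L" "A \<in> qbounded_ops"
    and "\<And>z. (\<And>p. blinfun_apply (L p) z = z *\<^sub>Q p) \<Longrightarrow> blinfun_apply A z = z *\<^sub>Q q"
  shows "L q = A"
  using assms left_scalar_mult_basis[OF assms(1)] left_scalar_mult_ops[OF assms(1)]
  by (metis blinfun_eq_on_basis)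

text \<open>At a basis vector, right linearity of \<open>L p\<close> gives L_p(L_q z) = L_p(zq) =
  (zp)q, so the order of the factors is kept.\<close>

lemma left_scalar_mult_times:
  assumes L: "left_scalar_mult L"
  shows "L (p * q) = L p o\<^sub>L L q"
  using L by (rule left_scalar_mult_eqI)
    (use left_scalar_mult_ops[OF L] in
      \<open>simp_all add: qbounded_ops_def scaleQ_scaleQ\<close>)

lemma left_scalar_mult_add:
  assumes L: "left_scalar_mult L"
  shows "L (p + q) = L p + L q"
  using L by (rule left_scalar_mult_eqI)
    (use left_scalar_mult_ops[OF L] in
      \<open>simp_all add: qbounded_ops_def blinfun.add_left scaleQ_add_left scaleQ_add_right\<close>)

lemma left_scalar_mult_scaleR_1:
  assumes L: "left_scalar_mult L"
  shows "L (r *\<^sub>R 1) = r *\<^sub>R id_blinfun"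
  using L by (rule left_scalar_mult_eqI)
    (simp_all add: qbounded_ops_def blinfun.scaleR_left scaleQ_scaleR_left scaleQ_scaleR_right
      scaleQ_one)

lemma left_scalar_mult_1: "left_scalar_mult L \<Longrightarrow> L 1 = id_blinfun"
  using left_scalar_mult_scaleR_1[of L 1] by simp

lemma left_scalar_mult_0: "left_scalar_mult L \<Longrightarrow> L 0 = 0"
  using left_scalar_mult_scaleR_1[of L 0] by simp

text \<open>For two basis vectors both sides are \<open>qcnj q\<close> multiplied by 0 or 1, on
  different sides; orthonormality is what makes them equal. The identity is then extended to all v,
  and after that to all u.\<close>

lemma left_scalar_mult_adjoint:
  assumes L: "left_scalar_mult L"
  shows "qinner (blinfun_apply (L q) u) v = qinner u (blinfun_apply (L (qcnj q)) v)"
proof -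
  obtain N where N: "hilbert_basis N" "\<And>z q. z \<in> N \<Longrightarrow> blinfun_apply (L q) z = z *\<^sub>Q q"
    using left_scalar_mult_basis[OF L] by metis
  let ?P = "\<lambda>u v. qinner (blinfun_apply (L q) u) v = qinner u (blinfun_apply (L (qcnj q)) v)"
  note lin = qbounded_ops_scaleQ[OF left_scalar_mult_ops[OF L]] blinfun.add_right blinfun.zero_right
    qinner_add_left qinner_add_right qinner_scaleQ_left qinner_scaleQ_right
  have 1: "?P z v" if "z \<in> N" for z v
  proof -
    have "v \<in> {v. ?P z v}"
      using N(1)
    proof (rule hilbert_basis_induct)
      show "closed {v. ?P z v}"
        by (intro closed_Collect_eq continuous_intros)
      show "N \<subseteq> {v. ?P z v}"
        using that N by (auto simp: hilbert_basis_def qinner_scaleQ_left qinner_scaleQ_right)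
    qed (simp add: qsubspace_def lin flip: mult.assoc)
    then show ?thesis by simp
  qed
  have "u \<in> {u. ?P u v}"
    using N(1)
  proof (rule hilbert_basis_induct)
    show "closed {u. ?P u v}"
      by (intro closed_Collect_eq continuous_intros)
  qed (auto simp add: qsubspace_def lin 1)
  then show ?thesis by simp
qed

text \<open>The adjoint of \<open>L q\<close> composed with \<open>L q\<close> is
  \<open>L (qcnj q * q)\<close>, a real multiple of the identity.\<close>

lemma left_scalar_mult_norm:
  assumes L: "left_scalar_mult L"
  shows "norm (blinfun_apply (L q) u) = norm q * norm u"
proof -
  have "(norm (blinfun_apply (L q) u))\<^sup>2 = qRe (qinner u (blinfun_apply (L (qcnj q * q)) u))"
    by (simp add: left_scalar_mult_times[OF L] left_scalar_mult_adjoint[OF L]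
        flip: qRe_qinner_self)
  also have "\<dots> = (norm q * norm u)\<^sup>2"
    by (simp add: qcnj_mult_self left_scalar_mult_scaleR_1[OF L] blinfun.scaleR_left
        qinner_scaleR_right qRe_qinner_self power_mult_distrib)
  finally show ?thesis by simp
qed

section \<open>Projections\<close>

text \<open>Over the quaternions positivity forces symmetry: with \<open>a = \<langle>u|Av\<rangle>\<close> and \<open>b = \<langle>v|Au\<rangle>\<close>,
  evaluating the form at \<open>u + vq\<close> shows that \<open>q\<^sup>*(b - a\<^sup>*)\<close> is real for every \<open>q\<close>.\<close>
lemma qpositive_symmetric:
  assumes A: "A \<in> qbounded_ops" "qpositive A"
  shows "qinner (blinfun_apply A u) v = qinner u (blinfun_apply A v)"
proof -
  let ?f = "\<lambda>u. qinner u (blinfun_apply A u)"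
  define a where "a = qinner u (blinfun_apply A v)"
  define b where "b = qinner v (blinfun_apply A u)"
  have real: "qI (?f w) = 0 \<and> qJ (?f w) = 0 \<and> qK (?f w) = 0" for w
  proof -
    have "?f w \<in> \<real>"
      using A(2) by (simp add: qpositive_def qnonneg_def)
    then obtain r where "?f w = of_real r"
      by (rule Reals_cases)
    then show ?thesis by (simp add: of_real_def)
  qed
  have exp: "?f (u + v *\<^sub>Q q) = ?f u + a * q + qcnj q * b + ?f (v *\<^sub>Q q)" for q
    by (simp add: a_def b_def qinner_add_left qinner_add_right blinfun.add_right
        qbounded_ops_scaleQ[OF A(1)] qinner_scaleQ_left qinner_scaleQ_right algebra_simps)
  have "qI (a * q + qcnj q * b) = 0 \<and> qJ (a * q + qcnj q * b) = 0 \<and> qK (a * q + qcnj q * b) = 0"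
    for q
    using exp[of q] real[of "u + v *\<^sub>Q q"] real[of u] real[of "v *\<^sub>Q q"]
    by (simp add: quat_eq_iff)
  from this[of 1] this[of "Quat 0 1 0 0"] this[of "Quat 0 0 1 0"] have "qcnj b = a"
    by (simp add: quat_eq_iff quat_mult_sel)
  then show ?thesis
    unfolding a_def b_def by (simp flip: qinner_commute)
qed

section \<open>The half plane\<close>

lemma imag_unit_sel:
  assumes "\<iota> \<in> imag_units"
  shows "qRe \<iota> = 0" "norm \<iota> = 1"
proof -
  have sq: "\<iota> * \<iota> = -1"
    using assms by (simp add: imag_units_def power2_eq_square)
  have "norm \<iota> * norm \<iota> = 1"
    using sq by (simp flip: norm_mult)
  then show "norm \<iota> = 1"
    by (simp add: power2_eq_1_iff flip: power2_eq_square) (use norm_ge_zero[of \<iota>] in linarith)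
  have "qRe (\<iota> * \<iota>) = -1" "qI (\<iota> * \<iota>) = 0" "qJ (\<iota> * \<iota>) = 0" "qK (\<iota> * \<iota>) = 0"
    by (simp_all add: sq)
  \<comment> \<open>A non-zero real part would force the three imaginary components to vanish, and a
    real square is not -1.\<close>
  then show "qRe \<iota> = 0"
    by (auto simp: quat_mult_sel) (smt (verit) mult_zero_left zero_le_square)+
qed

text \<open>\<iota> is a unit vector orthogonal to 1, so \<open>inner \<iota> z\<close> recovers the
  coefficient \<beta>. This trades the existential description for continuous conditions, from which
  closedness follows.\<close>

lemma half_plane_iff:
  assumes "\<iota> \<in> imag_units"
  shows "z \<in> half_plane \<iota> \<longleftrightarrow> z = qRe z *\<^sub>R 1 + inner \<iota> z *\<^sub>R \<iota> \<and> 0 \<le> inner \<iota> z"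
proof
  assume "z \<in> half_plane \<iota>"
  then obtain a b where z: "z = a *\<^sub>R 1 + b *\<^sub>R \<iota>" "b \<ge> 0"
    by (auto simp: half_plane_def of_real_def)
  have "inner \<iota> \<iota> = 1"
    using imag_unit_sel[OF assms] by (simp flip: power2_norm_eq_inner)
  then have "inner \<iota> z = b" "qRe z = a"
    using imag_unit_sel[OF assms] z by (simp_all add: inner_add_right, simp add: inner_quat_def)
  with z show "z = qRe z *\<^sub>R 1 + inner \<iota> z *\<^sub>R \<iota> \<and> 0 \<le> inner \<iota> z" by simp
next
  assume "z = qRe z *\<^sub>R 1 + inner \<iota> z *\<^sub>R \<iota> \<and> 0 \<le> inner \<iota> z"
  then show "z \<in> half_plane \<iota>"
    unfolding half_plane_def by (auto simp: of_real_def)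
qed

lemma continuous_on_qRe [continuous_intros]:
  "continuous_on S f \<Longrightarrow> continuous_on S (\<lambda>x. qRe (f x))"
  by (rule bounded_linear.continuous_on[OF bounded_linear_qRe])

lemma closed_half_plane:
  assumes "\<iota> \<in> imag_units"
  shows "closed (half_plane \<iota>)"
proof -
  have "half_plane \<iota> = {z. z = qRe z *\<^sub>R 1 + inner \<iota> z *\<^sub>R \<iota>} \<inter> {z. 0 \<le> inner \<iota> z}"
    using half_plane_iff[OF assms] by blast
  then show ?thesis
    by (simp only:) (intro closed_Int closed_Collect_eq closed_Collect_le continuous_intros)
qed

text \<open>The factorisation needs z and q to commute, which holds since both lie in the plane
  spanned by 1 and \<iota>. The inequality needs them on the same side of the real axis: for b, d
  nonnegative, |b - d| is at most b + d.\<close>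

lemma half_plane_conj_poly:
  assumes "\<iota> \<in> imag_units" "z \<in> half_plane \<iota>" "q \<in> half_plane \<iota>"
  shows "z * z - (2 * qRe q) *\<^sub>R z + (norm q)\<^sup>2 *\<^sub>R 1 = (z - q) * (z - qcnj q)"
    and "norm (z - q) \<le> norm (z - qcnj q)"
proof -
  obtain a b c d where z: "z = a *\<^sub>R 1 + b *\<^sub>R \<iota>" "b \<ge> 0" and q: "q = c *\<^sub>R 1 + d *\<^sub>R \<iota>" "d \<ge> 0"
    using assms(2,3) unfolding half_plane_def by (auto simp: of_real_def)
  have comm: "z * q = q * z"
    unfolding z q by (simp add: algebra_simps)
  have conj: "qcnj q = (2 * qRe q) *\<^sub>R 1 - q"
    by (simp add: quat_eq_iff)
  have "(norm q)\<^sup>2 *\<^sub>R 1 = q * ((2 * qRe q) *\<^sub>R 1 - q)"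
    unfolding conj[symmetric] by (simp add: qcnj_mult_self)
  then show "z * z - (2 * qRe q) *\<^sub>R z + (norm q)\<^sup>2 *\<^sub>R 1 = (z - q) * (z - qcnj q)"
    unfolding conj by (simp add: algebra_simps comm)
  have "qcnj \<iota> = - \<iota>"
    using imag_unit_sel(1)[OF assms(1)] by (simp add: quat_eq_iff)
  then have qc: "qcnj q = c *\<^sub>R 1 - d *\<^sub>R \<iota>"
    by (simp add: q)
  have n: "(norm (x *\<^sub>R 1 + y *\<^sub>R \<iota>))\<^sup>2 = x\<^sup>2 + y\<^sup>2" for x y
  proof -
    have "(norm (x *\<^sub>R 1 + y *\<^sub>R \<iota>))\<^sup>2 = x\<^sup>2 + y\<^sup>2 * (norm \<iota>)\<^sup>2"
      unfolding norm_quat_sq using imag_unit_sel(1)[OF assms(1)]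
      by (simp add: power2_eq_square algebra_simps)
    then show ?thesis
      using imag_unit_sel(2)[OF assms(1)] by simp
  qed
  have "z - q = (a - c) *\<^sub>R 1 + (b - d) *\<^sub>R \<iota>" "z - qcnj q = (a - c) *\<^sub>R 1 + (b + d) *\<^sub>R \<iota>"
    unfolding z qc by (simp_all add: q algebra_simps)
  moreover have "(b - d)\<^sup>2 \<le> (b + d)\<^sup>2"
    using z q by (simp add: power2_sum power2_diff)
  ultimately have "(norm (z - q))\<^sup>2 \<le> (norm (z - qcnj q))\<^sup>2"
    by (simp add: n)
  then show "norm (z - q) \<le> norm (z - qcnj q)"
    by (rule power2_le_imp_le) simp
qed

section \<open>Spectral measures\<close>

locale iqpvm_space =
  fixes \<iota> :: quat
    and Q :: "quat set \<Rightarrow> 'h::quat_hilbert \<Rightarrow>\<^sub>L 'h"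
    and L :: "quat \<Rightarrow> 'h \<Rightarrow>\<^sub>L 'h"
  assumes imag: "\<iota> \<in> imag_units" and iqpvm: "iqpvm \<iota> Q L"
begin

abbreviation \<Omega> :: "quat set" where "\<Omega> \<equiv> half_plane \<iota>"
abbreviation M :: "quat measure" where "M \<equiv> half_plane_borel \<iota>"
abbreviation \<mu> :: "'h \<Rightarrow> quat measure" where "\<mu> \<equiv> spectral_measure \<iota> Q"

lemma left_scalar_mult: "left_scalar_mult L"
  using iqpvm by (simp add: iqpvm_def)

lemmas L_times = left_scalar_mult_times[OF left_scalar_mult]
  and L_add = left_scalar_mult_add[OF left_scalar_mult]
  and L_1 = left_scalar_mult_1[OF left_scalar_mult]
  and L_0 = left_scalar_mult_0[OF left_scalar_mult]
  and norm_L = left_scalar_mult_norm[OF left_scalar_mult]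
  and L_scaleR_1 = left_scalar_mult_scaleR_1[OF left_scalar_mult]

lemma qpvm: "qpvm \<iota> Q"
  using iqpvm by (simp add: iqpvm_def)

lemma space_M [simp]: "space M = \<Omega>"
  by (simp add: space_restrict_space)

lemma half_plane_borel [measurable]: "\<Omega> \<in> sets borel"
  using closed_half_plane[OF imag] by simp

lemma sets_M: "E \<in> sets M \<longleftrightarrow> E \<in> sets borel \<and> E \<subseteq> \<Omega>"
  by (auto simp: sets_restrict_space_iff)

lemma sets_M_space [simp]: "\<Omega> \<in> sets M"
  by (simp add: sets_M)

lemma half_plane_nonempty: "0 \<in> \<Omega>"
  by (simp add: half_plane_iff[OF imag])

lemma Q_ops: "E \<in> sets M \<Longrightarrow> Q E \<in> qbounded_ops"
  using qpvm by (simp add: qpvm_def)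

lemma Q_Int:
  assumes "E \<in> sets M" "F \<in> sets M"
  shows "blinfun_apply (Q E) (blinfun_apply (Q F) u) = blinfun_apply (Q (E \<inter> F)) u"
proof -
  have "Q E o\<^sub>L Q F = Q (E \<inter> F)"
    using qpvm assms by (simp add: qpvm_def)
  then show ?thesis by (metis blinfun_apply_blinfun_compose)
qed

lemma Q_space [simp]: "Q \<Omega> = id_blinfun"
  using qpvm by (simp add: qpvm_def)

lemma Q_sums:
  assumes "range E \<subseteq> sets M" "disjoint_family E"
  shows "(\<lambda>n::nat. blinfun_apply (Q (E n)) u) sums blinfun_apply (Q (\<Union>n. E n)) u"
  using qpvm assms by (simp add: qpvm_def)

text \<open>Countable additivity for the constant family of empty sets gives a convergent series
  with constant terms.\<close>

lemma Q_empty [simp]: "Q {} = 0"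
proof (rule blinfun_eqI)
  fix u
  have "(\<lambda>n::nat. blinfun_apply (Q {}) u) sums blinfun_apply (Q (\<Union>n::nat. {})) u"
    by (rule Q_sums) (auto simp: disjoint_family_on_def)
  then have "summable (\<lambda>n::nat. blinfun_apply (Q {}) u)"
    by (rule sums_summable)
  then show "blinfun_apply (Q {}) u = blinfun_apply 0 u"
    by (simp add: summable_const_iff)
qed

lemma Q_Un:
  assumes "E \<in> sets M" "F \<in> sets M" "E \<inter> F = {}"
  shows "Q (E \<union> F) = Q E + Q F"
proof (rule blinfun_eqI)
  fix u
  have "(\<lambda>n. blinfun_apply (Q (binaryset E F n)) u) sums blinfun_apply (Q (\<Union>n. binaryset E F n)) u"
  proof (rule Q_sums)
    show "disjoint_family (binaryset E F)"
      using assms by (auto simp: disjoint_family_on_def binaryset_def)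
  qed (use assms in \<open>auto simp: range_binaryset_eq\<close>)
  moreover have "(\<lambda>n. blinfun_apply (Q (binaryset E F n)) u) sums
      (\<Sum>n\<in>{0,1}. blinfun_apply (Q (binaryset E F n)) u)"
    by (rule sums_finite) (auto simp: binaryset_def)
  ultimately have "blinfun_apply (Q (\<Union>n. binaryset E F n)) u =
      (\<Sum>n\<in>{0,1}. blinfun_apply (Q (binaryset E F n)) u)"
    by (rule sums_unique2)
  then show "blinfun_apply (Q (E \<union> F)) u = blinfun_apply (Q E + Q F) u"
    by (simp add: UN_binaryset_eq blinfun.add_left) (simp add: binaryset_def)
qed

lemma Q_finite_UN:
  assumes "finite I" "\<And>i. i \<in> I \<Longrightarrow> E i \<in> sets M" "disjoint_family_on E I"
  shows "Q (\<Union>i\<in>I. E i) = (\<Sum>i\<in>I. Q (E i))"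
  using assms
proof (induction I)
  case (insert i I)
  have "Q (E i \<union> (\<Union>i\<in>I. E i)) = Q (E i) + Q (\<Union>i\<in>I. E i)"
    using insert by (intro Q_Un sets.finite_UN) (auto simp: disjoint_family_on_def)
  moreover have "disjoint_family_on E I"
    using insert.prems by (auto simp: disjoint_family_on_def)
  ultimately show ?case
    using insert by simp
qed simp

lemma Q_L:
  assumes "E \<in> sets M"
  shows "blinfun_apply (Q E) (blinfun_apply (L q) u) = blinfun_apply (L q) (blinfun_apply (Q E) u)"
proof -
  have "Q E o\<^sub>L L q = L q o\<^sub>L Q E"
    using iqpvm assms by (simp add: iqpvm_def)
  then show ?thesis by (metis blinfun_apply_blinfun_compose)
qed

lemma Q_symmetric:
  "E \<in> sets M \<Longrightarrow> qinner (blinfun_apply (Q E) u) v = qinner u (blinfun_apply (Q E) v)"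
  using qpvm by (intro qpositive_symmetric) (simp_all add: qpvm_def)

lemma Q_norm_sq:
  assumes "E \<in> sets M"
  shows "qRe (qinner u (blinfun_apply (Q E) u)) = (norm (blinfun_apply (Q E) u))\<^sup>2"
proof -
  have "qinner u (blinfun_apply (Q E) u) = qinner (blinfun_apply (Q E) u) (blinfun_apply (Q E) u)"
    using assms by (simp add: Q_symmetric Q_Int)
  then show ?thesis by (simp add: qRe_qinner_self)
qed

lemma Q_orthogonal:
  assumes "E \<in> sets M" "F \<in> sets M" "E \<inter> F = {}"
  shows "qinner (blinfun_apply (Q E) u) (blinfun_apply (Q F) v) = 0"
  using assms by (simp add: Q_symmetric Q_Int)

lemma sets_spectral_measure [simp, measurable_cong]: "sets (\<mu> u) = sets M"
  using sets.sigma_sets_eq[of M] sets.space_closed[of M]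
  by (simp add: spectral_measure_def sets_measure_of)

lemma space_spectral_measure [simp]: "space (\<mu> u) = \<Omega>"
  using sets_eq_imp_space_eq[OF sets_spectral_measure] by simp

text \<open>\<open>measure_of\<close> returns the intended values only once countable additivity is
  proved. That follows by applying the continuous real linear map v \<mapsto> Re
  \<langle>u|v\<rangle> to the strong convergence of the projections.\<close>

lemma emeasure_spectral_measure:
  assumes "E \<in> sets M"
  shows "emeasure (\<mu> u) E = ennreal ((norm (blinfun_apply (Q E) u))\<^sup>2)"
proof -
  let ?m = "\<lambda>E. ennreal (qRe (qinner u (blinfun_apply (Q E) u)))"
  have "emeasure (\<mu> u) E = ?m E"
    unfolding spectral_measure_def
  proof (rule emeasure_measure_of_sigma)
    show "sigma_algebra \<Omega> (sets M)"
      using sets.sigma_algebra_axioms[of M] by simp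
    show "positive (sets M) ?m"
      by (simp add: positive_def)
    show "countably_additive (sets M) ?m"
    proof (rule countably_additiveI)
      fix E :: "nat \<Rightarrow> quat set"
      assume E: "range E \<subseteq> sets M" "disjoint_family E" "(\<Union>n. E n) \<in> sets M"
      have lin: "bounded_linear (\<lambda>v. qRe (qinner u v))"
        by (rule bounded_linear_compose[OF bounded_linear_qRe
              bounded_bilinear.bounded_linear_right[OF bounded_bilinear_qinner]])
      have "(\<lambda>n. qRe (qinner u (blinfun_apply (Q (E n)) u))) sums
          qRe (qinner u (blinfun_apply (Q (\<Union>n. E n)) u))"
        using bounded_linear.sums[OF lin Q_sums[OF E(1,2)]] .
      moreover have "0 \<le> qRe (qinner u (blinfun_apply (Q (E n)) u))" for n
        using E(1) by (simp add: Q_norm_sq range_subsetD)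
      ultimately show "(\<Sum>n. ?m (E n)) = ?m (\<Union>n. E n)"
        by (intro suminf_ennreal_eq)
    qed
  qed fact
  then show ?thesis
    using assms by (simp add: Q_norm_sq)
qed

lemma emeasure_spectral_measure_space [simp]: "emeasure (\<mu> u) \<Omega> = ennreal ((norm u)\<^sup>2)"
  by (simp add: emeasure_spectral_measure)

text \<open>The bridge between measure and operator: E is null for the measure of u exactly when
  \<open>Q E\<close> annihilates u.\<close>

lemma AE_spectral_measure_iff:
  assumes [measurable]: "Measurable.pred M P"
  shows "(AE z in \<mu> u. P z) \<longleftrightarrow> blinfun_apply (Q {z\<in>\<Omega>. \<not> P z}) u = 0"
proof -
  have "{z\<in>space M. \<not> P z} \<in> sets M" by measurable
  then have "{z\<in>\<Omega>. \<not> P z} \<in> sets M" by simp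
  then show ?thesis
    by (simp add: AE_iff_measurable[OF _ refl] emeasure_spectral_measure)
qed

end

section \<open>Integrals of bounded functions\<close>

text \<open>Each coordinate is rounded down to the grid of mesh 1/(n+1). The error is at most one
  mesh per coordinate, hence the dimension in the bound.\<close>

lemma simple_function_uniform_approx:
  fixes f :: "'a \<Rightarrow> 'b::euclidean_space"
  assumes f[measurable]: "f \<in> borel_measurable M" and B: "\<And>x. x \<in> space M \<Longrightarrow> norm (f x) \<le> B"
  obtains s :: "nat \<Rightarrow> 'a \<Rightarrow> 'b" where "\<And>n. simple_function M (s n)"
    "\<And>n x. norm (s n x - f x) \<le> real DIM('b) / Suc n"
proof -
  define g :: "nat \<Rightarrow> real \<Rightarrow> real" where
    "g n x = of_int \<lfloor>x * Suc n\<rfloor> / Suc n" for n and x :: real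
  define s :: "nat \<Rightarrow> 'a \<Rightarrow> 'b" where "s n x = (\<Sum>b\<in>Basis. g n (f x \<bullet> b) *\<^sub>R b)" for n x
  have g: "\<bar>g n x - x\<bar> \<le> 1 / Suc n" for n and x :: real
  proof -
    have "\<bar>of_int \<lfloor>x * Suc n\<rfloor> - x * Suc n\<bar> \<le> 1"
      by linarith
    moreover have "(g n x - x) = (of_int \<lfloor>x * Suc n\<rfloor> - x * Suc n) / Suc n"
      by (simp add: g_def field_simps)
    ultimately show ?thesis
      by (simp add: divide_right_mono)
  qed
  have [measurable]: "g n \<in> borel_measurable borel" for n
    unfolding g_def[abs_def] by measurable
  have "simple_function M (s n)" for n
    unfolding s_def
  proof (intro simple_function_sum simple_function_compose1[where g = "\<lambda>x. x *\<^sub>R b" for b])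
    fix b :: 'b assume b: "b \<in> Basis"
    show "simple_function M (\<lambda>x. g n (f x \<bullet> b))"
    proof (rule simple_function_borel_measurable)
      \<comment> \<open>Boundedness of f enters here: only finitely many grid values occur.\<close>
      have "\<lfloor>(f x \<bullet> b) * Suc n\<rfloor> \<in> {\<lfloor>- B * Suc n\<rfloor>..\<lfloor>B * Suc n\<rfloor>}" if "x \<in> space M" for x
      proof -
        have "\<bar>f x \<bullet> b\<bar> \<le> B"
          using Basis_le_norm[OF b, of "f x"] B[OF that] by linarith
        then have "- B * Suc n \<le> (f x \<bullet> b) * Suc n" "(f x \<bullet> b) * Suc n \<le> B * Suc n"
          by (intro mult_right_mono; simp)+
        then show ?thesis
          by (simp only: atLeastAtMost_iff floor_mono)
      qed
      then have "(\<lambda>x. g n (f x \<bullet> b)) ` space M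
          \<subseteq> (\<lambda>k. of_int k / Suc n) ` {\<lfloor>- B * Suc n\<rfloor>..\<lfloor>B * Suc n\<rfloor>}"
        unfolding g_def by blast
      then show "finite ((\<lambda>x. g n (f x \<bullet> b)) ` space M)"
        by (rule finite_subset) simp
    qed measurable
  qed
  moreover have "norm (s n x - f x) \<le> real DIM('b) / Suc n" for n x
  proof -
    have "s n x - f x = (\<Sum>b\<in>Basis. (g n (f x \<bullet> b) - f x \<bullet> b) *\<^sub>R b)"
      by (simp add: s_def scaleR_diff_left sum_subtractf euclidean_representation)
    also have "norm \<dots> \<le> (\<Sum>b\<in>(Basis::'b set). 1 / Suc n)"
      by (rule sum_norm_le) (use g in simp)
    finally show ?thesis by simp
  qed
  ultimately show thesis by (rule that)
qed

lemma norm_sum_orthogonal_sq: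
  fixes f :: "'i \<Rightarrow> 'h::quat_hilbert"
  assumes "finite I" "\<And>i j. i \<in> I \<Longrightarrow> j \<in> I \<Longrightarrow> i \<noteq> j \<Longrightarrow> qinner (f i) (f j) = 0"
  shows "(norm (\<Sum>i\<in>I. f i))\<^sup>2 = (\<Sum>i\<in>I. (norm (f i))\<^sup>2)"
  using assms
proof (induction I)
  case (insert i I)
  have "qinner (f i) (\<Sum>j\<in>I. f j) = (\<Sum>j\<in>I. qinner (f i) (f j))"
    by (rule bounded_bilinear.sum_right[OF bounded_bilinear_qinner])
  also have "\<dots> = 0"
    using insert by (intro sum.neutral) auto
  finally show ?case
    using insert by (simp add: norm_add_sq)
qed simp

context iqpvm_space
begin

section \<open>Integrals of simple functions\<close>

abbreviation sint :: "(quat \<Rightarrow> quat) \<Rightarrow> 'h \<Rightarrow>\<^sub>L 'h" where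
  "sint \<equiv> iq_integral_simple \<iota> Q L"
abbreviation bint :: "(quat \<Rightarrow> quat) \<Rightarrow> 'h \<Rightarrow>\<^sub>L 'h" where
  "bint \<equiv> iq_integral_bounded \<iota> Q L"

lemma simple_function_level_set [simp]:
  "simple_function M r \<Longrightarrow> r -` X \<inter> \<Omega> \<in> sets M"
  using simple_functionD(2)[of M r X] by simp

text \<open>The integral is defined through the level sets of the integrand itself, which differ
  from function to function. Here it is rewritten over the level sets of r. With r the pair of s and
  t this is the common refinement, and k is then a projection, the sum or the product; hence the
  unrestricted type of the values of r.\<close>

lemma sint_comp:
  assumes r: "simple_function M r"
  shows "sint (\<lambda>z. k (r z)) = (\<Sum>a\<in>r ` \<Omega>. L (k a) o\<^sub>L Q (r -` {a} \<inter> \<Omega>))"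
proof -
  have fin: "finite (r ` \<Omega>)"
    using simple_functionD(1)[OF r] by simp
  have level: "Q ((\<lambda>z. k (r z)) -` {p} \<inter> \<Omega>) = (\<Sum>a\<in>{a\<in>r ` \<Omega>. k a = p}. Q (r -` {a} \<inter> \<Omega>))" for p
  proof -
    have "(\<lambda>z. k (r z)) -` {p} \<inter> \<Omega> = (\<Union>a\<in>{a\<in>r ` \<Omega>. k a = p}. r -` {a} \<inter> \<Omega>)"
      by auto
    then show ?thesis
      using fin r by (simp only:) (intro Q_finite_UN, auto simp: disjoint_family_on_def)
  qed
  have "sint (\<lambda>z. k (r z)) =
      (\<Sum>p\<in>k ` r ` \<Omega>. \<Sum>a\<in>{a\<in>r ` \<Omega>. k a = p}. L (k a) o\<^sub>L Q (r -` {a} \<inter> \<Omega>))"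
    unfolding iq_integral_simple_def level image_image
    by (simp add: bounded_bilinear.sum_right[OF bounded_bilinear_blinfun_compose])
  also have "\<dots> = (\<Sum>a\<in>r ` \<Omega>. L (k a) o\<^sub>L Q (r -` {a} \<inter> \<Omega>))"
    by (rule sum.image_gen[OF fin, symmetric])
  finally show ?thesis .
qed

lemma sint_add:
  assumes "simple_function M s" "simple_function M t"
  shows "sint (\<lambda>z. s z + t z) = sint s + sint t"
  using sint_comp[OF simple_function_Pair[OF assms], of "\<lambda>x. fst x + snd x"]
    sint_comp[OF simple_function_Pair[OF assms], of fst]
    sint_comp[OF simple_function_Pair[OF assms], of snd]
  by (simp add: L_add sum.distrib bounded_bilinear.add_left[OF bounded_bilinear_blinfun_compose])

lemma sint_diff:
  assumes "simple_function M s" "simple_function M t"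
  shows "sint (\<lambda>z. s z - t z) = sint s - sint t"
proof -
  have "sint (\<lambda>z. (s z - t z) + t z) = sint (\<lambda>z. s z - t z) + sint t"
    using assms by (intro sint_add) auto
  then show ?thesis by simp
qed

text \<open>Moving \<open>L\<close> past \<open>Q\<close> turns a product of two terms into a
  product of scalars times \<open>Q\<close> of an intersection of level sets. The level sets of the
  pair are disjoint, so only the diagonal terms remain.\<close>

lemma sint_mult:
  assumes "simple_function M s" "simple_function M t"
  shows "sint (\<lambda>z. s z * t z) = sint s o\<^sub>L sint t"
proof -
  let ?r = "\<lambda>z. (s z, t z)"
  note r = simple_function_Pair[OF assms]
  have fin: "finite (?r ` \<Omega>)"
    using simple_functionD(1)[OF r] by simp
  let ?Q = "\<lambda>x. Q (?r -` {x} \<inter> \<Omega>)"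
  have prod: "(L (fst x) o\<^sub>L ?Q x) o\<^sub>L (L (snd y) o\<^sub>L ?Q y) =
      (if x = y then L (fst x * snd x) o\<^sub>L ?Q x else 0)" for x y
  proof (rule blinfun_eqI)
    fix u
    have "(?r -` {x} \<inter> \<Omega>) \<inter> (?r -` {y} \<inter> \<Omega>) = (if x = y then ?r -` {x} \<inter> \<Omega> else {})"
      by auto
    then show "blinfun_apply ((L (fst x) o\<^sub>L ?Q x) o\<^sub>L (L (snd y) o\<^sub>L ?Q y)) u =
        blinfun_apply (if x = y then L (fst x * snd x) o\<^sub>L ?Q x else 0) u"
      using simple_function_level_set[OF r]
      by (simp add: Q_L Q_Int L_times)
  qed
  have "sint s o\<^sub>L sint t =
      (\<Sum>x\<in>?r ` \<Omega>. L (fst x) o\<^sub>L ?Q x) o\<^sub>L (\<Sum>y\<in>?r ` \<Omega>. L (snd y) o\<^sub>L ?Q y)"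
    using sint_comp[OF r, of fst] sint_comp[OF r, of snd] by simp
  also have "\<dots> = (\<Sum>x\<in>?r ` \<Omega>. \<Sum>y\<in>?r ` \<Omega>. (L (fst x) o\<^sub>L ?Q x) o\<^sub>L (L (snd y) o\<^sub>L ?Q y))"
    by (simp only: bounded_bilinear.sum_left[OF bounded_bilinear_blinfun_compose]
        bounded_bilinear.sum_right[OF bounded_bilinear_blinfun_compose]) (rule sum.swap)
  also have "\<dots> = (\<Sum>x\<in>?r ` \<Omega>. L (fst x * snd x) o\<^sub>L ?Q x)"
    unfolding prod using fin by simp
  also have "\<dots> = sint (\<lambda>z. s z * t z)"
    using sint_comp[OF r, of "\<lambda>x. fst x * snd x"] by simp
  finally show ?thesis by simp
qed

text \<open>Pythagoras: disjoint level sets give orthogonal summands, and \<open>L a\<close> scales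
  norms by |a|.\<close>

lemma sint_norm:
  assumes s: "simple_function M s"
  shows "ennreal ((norm (blinfun_apply (sint s) u))\<^sup>2) = (\<integral>\<^sup>+z. ennreal ((norm (s z))\<^sup>2) \<partial>\<mu> u)"
proof -
  let ?E = "\<lambda>a::quat. s -` {a} \<inter> \<Omega>"
  have fin: "finite (s ` \<Omega>)"
    using simple_functionD(1)[OF s] by simp
  have "blinfun_apply (sint s) u = (\<Sum>a\<in>s ` \<Omega>. blinfun_apply (L a) (blinfun_apply (Q (?E a)) u))"
    unfolding iq_integral_simple_def
    by (simp add: blinfun.sum_left)
  also have "(norm \<dots>)\<^sup>2 = (\<Sum>a\<in>s ` \<Omega>. (norm (blinfun_apply (L a) (blinfun_apply (Q (?E a)) u)))\<^sup>2)"
  proof (rule norm_sum_orthogonal_sq[OF fin])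
    fix a b :: quat assume "a \<noteq> b"
    then have "?E a \<inter> ?E b = {}" by auto
    \<comment> \<open>Each \<open>L\<close> is moved inside its projection, so that orthogonality of
      the ranges of \<open>Q\<close> applies.\<close>
    then show "qinner (blinfun_apply (L a) (blinfun_apply (Q (?E a)) u))
        (blinfun_apply (L b) (blinfun_apply (Q (?E b)) u)) = 0"
      using s by (simp add: Q_orthogonal flip: Q_L)
  qed
  also have "ennreal \<dots> = (\<Sum>a\<in>s ` \<Omega>. ennreal ((norm a)\<^sup>2) * emeasure (\<mu> u) (?E a))"
    using s by (simp add: norm_L power_mult_distrib emeasure_spectral_measure ennreal_mult flip:
        sum_ennreal)
  also have "\<dots> = (\<integral>\<^sup>+z. (\<Sum>a\<in>s ` \<Omega>. ennreal ((norm a)\<^sup>2) * indicator (?E a) z) \<partial>\<mu> u)"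
  proof -
    have [measurable]: "?E a \<in> sets (\<mu> u)" for a
      using s by simp
    show ?thesis
      by (subst nn_integral_sum) (simp_all add: nn_integral_cmult_indicator s)
  qed
  also have "\<dots> = (\<integral>\<^sup>+z. ennreal ((norm (s z))\<^sup>2) \<partial>\<mu> u)"
  proof (rule nn_integral_cong)
    fix z assume "z \<in> space (\<mu> u)"
    then have "z \<in> \<Omega>" by simp
    then have "(\<Sum>a\<in>s ` \<Omega>. ennreal ((norm a)\<^sup>2) * indicator (?E a) z) =
        (\<Sum>a\<in>s ` \<Omega>. if s z = a then ennreal ((norm a)\<^sup>2) else 0)"
      by (intro sum.cong) (auto simp: indicator_def)
    then show "(\<Sum>a\<in>s ` \<Omega>. ennreal ((norm a)\<^sup>2) * indicator (?E a) z) = ennreal ((norm (s z))\<^sup>2)"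
      using fin \<open>z \<in> \<Omega>\<close> by simp
  qed
  finally show ?thesis .
qed

lemma sint_le:
  assumes s: "simple_function M s" and C: "0 \<le> C" "\<And>z. z \<in> \<Omega> \<Longrightarrow> norm (s z) \<le> C"
  shows "norm (sint s) \<le> C"
proof (rule norm_blinfun_bound[OF C(1)])
  fix u
  have "ennreal ((norm (blinfun_apply (sint s) u))\<^sup>2) \<le> (\<integral>\<^sup>+z. ennreal (C\<^sup>2) \<partial>\<mu> u)"
    unfolding sint_norm[OF s] using C
    by (intro nn_integral_mono ennreal_leI power_mono) auto
  also have "\<dots> = ennreal ((C * norm u)\<^sup>2)"
    by (simp add: power_mult_distrib ennreal_mult)
  finally have "(norm (blinfun_apply (sint s) u))\<^sup>2 \<le> (C * norm u)\<^sup>2"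
    by (simp add: ennreal_le_iff)
  then show "norm (blinfun_apply (sint s) u) \<le> C * norm u"
    by (rule power2_le_imp_le) (simp add: C(1))
qed

text \<open>The definition by \<open>THE\<close> requires both a limit for one sequence and
  independence of the sequence.\<close>

lemma sint_tendsto:
  assumes s: "\<And>n. simple_function M (s n)" and lim: "uniform_limit \<Omega> s \<phi> sequentially"
  shows "(\<lambda>n. sint (s n)) \<longlonglongrightarrow> bint \<phi>"
proof -
  \<comment> \<open>Comparing two sequences serves twice: with equal ones it is the Cauchy property,
    with different ones it shows that the limits coincide.\<close>
  have close: "\<exists>N. \<forall>n\<ge>N. \<forall>m\<ge>N. norm (sint (t n) - sint (t' m)) < e"
    if t: "\<And>n. simple_function M (t n)" "uniform_limit \<Omega> t \<phi> sequentially"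
      and t': "\<And>n. simple_function M (t' n)" "uniform_limit \<Omega> t' \<phi> sequentially"
      and e: "e > 0" for t t' e
  proof -
    \<comment> \<open>Thirds rather than halves, because \<open>sint_le\<close> yields a weak
      inequality and 2e/3 is still below e.\<close>
    from e have "e / 3 > 0" by simp
    obtain N N' where N: "\<And>n z. n \<ge> N \<Longrightarrow> z \<in> \<Omega> \<Longrightarrow> dist (t n z) (\<phi> z) < e / 3"
      and N': "\<And>n z. n \<ge> N' \<Longrightarrow> z \<in> \<Omega> \<Longrightarrow> dist (t' n z) (\<phi> z) < e / 3"
      using uniform_limitD[OF t(2) \<open>e / 3 > 0\<close>] uniform_limitD[OF t'(2) \<open>e / 3 > 0\<close>]
      unfolding eventually_sequentially by metis
    have "norm (sint (t n) - sint (t' m)) < e" if "n \<ge> max N N'" "m \<ge> max N N'" for n m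
    proof -
      have "norm (sint (\<lambda>z. t n z - t' m z)) \<le> 2 * e / 3"
      proof (rule sint_le)
        fix z assume "z \<in> \<Omega>"
        then have "dist (t n z) (\<phi> z) < e / 3" "dist (t' m z) (\<phi> z) < e / 3"
          using N N' that by auto
        then show "norm (t n z - t' m z) \<le> 2 * e / 3"
          using dist_triangle2[of "t n z" "t' m z" "\<phi> z"] by (simp add: dist_norm)
      qed (use t t' e in auto)
      then show ?thesis
        using e t t' by (simp add: sint_diff)
    qed
    then show ?thesis by blast
  qed
  have "Cauchy (\<lambda>n. sint (s n))"
    by (rule CauchyI) (rule close[OF s lim s lim])
  then obtain A where A: "(\<lambda>n. sint (s n)) \<longlonglongrightarrow> A"
    using Cauchy_convergent_iff convergent_def by blast
  have "bint \<phi> = A"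
    unfolding iq_integral_bounded_def
  proof (rule the_equality)
    show "\<exists>s. (\<forall>n. simple_function M (s n)) \<and> uniform_limit \<Omega> s \<phi> sequentially \<and>
        (\<lambda>n. sint (s n)) \<longlonglongrightarrow> A"
      using s lim A by blast
  next
    fix A'
    assume "\<exists>s. (\<forall>n. simple_function M (s n)) \<and> uniform_limit \<Omega> s \<phi> sequentially \<and>
        (\<lambda>n. sint (s n)) \<longlonglongrightarrow> A'"
    then obtain t where t: "\<And>n. simple_function M (t n)" "uniform_limit \<Omega> t \<phi> sequentially"
      "(\<lambda>n. sint (t n)) \<longlonglongrightarrow> A'" by blast
    have "(\<lambda>n. sint (t n) - sint (s n)) \<longlonglongrightarrow> 0"
    proof (rule LIMSEQ_I)
      fix r :: real assume "r > 0"
      then obtain N where "\<And>n m. n \<ge> N \<Longrightarrow> m \<ge> N \<Longrightarrow> norm (sint (t n) - sint (s m)) < r"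
        using close[OF t(1,2) s lim] by metis
      then show "\<exists>N. \<forall>n\<ge>N. norm (sint (t n) - sint (s n) - 0) < r"
        by auto
    qed
    moreover have "(\<lambda>n. sint (t n) - sint (s n)) \<longlonglongrightarrow> A' - A"
      by (intro tendsto_diff t A)
    ultimately have "A' - A = 0"
      using LIMSEQ_unique by blast
    then show "A' = A" by simp
  qed
  with A show ?thesis by simp
qed

section \<open>From simple to bounded Borel integrands\<close>

definition bounded_borel :: "(quat \<Rightarrow> quat) \<Rightarrow> bool" where
  "bounded_borel f \<longleftrightarrow> f \<in> borel_measurable M \<and> (\<exists>B. \<forall>z\<in>\<Omega>. norm (f z) \<le> B)"

lemma bounded_borelI:
  "f \<in> borel_measurable M \<Longrightarrow> (\<And>z. z \<in> \<Omega> \<Longrightarrow> norm (f z) \<le> B) \<Longrightarrow> bounded_borel f"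
  unfolding bounded_borel_def by blast

lemma bounded_borel_measurable: "bounded_borel f \<Longrightarrow> f \<in> borel_measurable M"
  by (simp add: bounded_borel_def)

lemma bounded_borel_bounded: "bounded_borel f \<Longrightarrow> bounded (f ` \<Omega>)"
  unfolding bounded_borel_def bounded_iff by blast

text \<open>The common bound on the approximants is the dominating constant in
  \<open>bint_norm_nn_integral\<close>.\<close>

lemma bounded_borel_approx:
  assumes "bounded_borel f"
  obtains s B where "\<And>n. simple_function M (s n)" "uniform_limit \<Omega> s f sequentially"
    "\<And>n z. z \<in> \<Omega> \<Longrightarrow> norm (s n z) \<le> B"
proof -
  from assms obtain B where [measurable]: "f \<in> borel_measurable M"
      and B: "\<And>z. z \<in> \<Omega> \<Longrightarrow> norm (f z) \<le> B"
    unfolding bounded_borel_def by blast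
  have "\<exists>s. (\<forall>n. simple_function M (s n)) \<and> (\<forall>n x. norm (s n x - f x) \<le> real DIM(quat) / Suc n)"
    by (rule simple_function_uniform_approx[of f M B]) (use B in auto)
  then obtain s where s: "\<And>n. simple_function M (s n)"
    and close: "\<And>n x. norm (s n x - f x) \<le> real DIM(quat) / Suc n"
    by blast
  have "uniform_limit \<Omega> s f sequentially"
  proof (rule uniform_limitI)
    fix e :: real assume "e > 0"
    have "(\<lambda>n. real DIM(quat) / Suc n) \<longlonglongrightarrow> 0"
      by (rule LIMSEQ_Suc) (rule lim_const_over_n)
    then have "\<forall>\<^sub>F n in sequentially. real DIM(quat) / Suc n < e"
      using \<open>e > 0\<close> by (rule order_tendstoD)
    then show "\<forall>\<^sub>F n in sequentially. \<forall>z\<in>\<Omega>. dist (s n z) (f z) < e"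
      by eventually_elim (use close in \<open>auto simp: dist_norm intro: le_less_trans\<close>)
  qed
  moreover have "norm (s n z) \<le> B + real DIM(quat)" if "z \<in> \<Omega>" for n z
  proof -
    have "real DIM(quat) / Suc n \<le> real DIM(quat)"
      by (simp add: divide_le_eq)
    then show ?thesis
      using close[of n z] B[OF that] norm_triangle_ineq2[of "s n z" "f z"] by linarith
  qed
  ultimately show thesis by (rule that[OF s])
qed

text \<open>The isometry passes from simple functions to the limit by dominated convergence; a
  constant dominates because the spectral measure is finite.\<close>

lemma bint_norm_nn_integral:
  assumes f: "bounded_borel f"
  shows "ennreal ((norm (blinfun_apply (bint f) u))\<^sup>2) = (\<integral>\<^sup>+z. ennreal ((norm (f z))\<^sup>2) \<partial>\<mu> u)"
proof -
  obtain s B where s: "\<And>n. simple_function M (s n)" "uniform_limit \<Omega> s f sequentially"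
    and B: "\<And>n z. z \<in> \<Omega> \<Longrightarrow> norm (s n z) \<le> B"
    using bounded_borel_approx[OF f] by metis
  have [measurable]: "f \<in> borel_measurable M" "\<And>n. s n \<in> borel_measurable M"
    using bounded_borel_measurable[OF f] borel_measurable_simple_function[OF s(1)] by auto
  have "(\<lambda>n. blinfun_apply (sint (s n)) u) \<longlonglongrightarrow> blinfun_apply (bint f) u"
    by (rule blinfun.tendsto[OF sint_tendsto[OF s] tendsto_const])
  then have "(\<lambda>n. ennreal ((norm (blinfun_apply (sint (s n)) u))\<^sup>2)) \<longlonglongrightarrow>
      ennreal ((norm (blinfun_apply (bint f) u))\<^sup>2)"
    by (intro tendsto_ennrealI tendsto_power tendsto_norm)
  moreover have "(\<lambda>n. \<integral>\<^sup>+z. ennreal ((norm (s n z))\<^sup>2) \<partial>\<mu> u) \<longlonglongrightarrow>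
      (\<integral>\<^sup>+z. ennreal ((norm (f z))\<^sup>2) \<partial>\<mu> u)"
  proof (rule nn_integral_dominated_convergence[where w = "\<lambda>z. ennreal (B\<^sup>2)"])
    show "AE z in \<mu> u. ennreal ((norm (s n z))\<^sup>2) \<le> ennreal (B\<^sup>2)" for n
      using B by (intro AE_I2 ennreal_leI power_mono) auto
    show "AE z in \<mu> u. (\<lambda>n. ennreal ((norm (s n z))\<^sup>2)) \<longlonglongrightarrow> ennreal ((norm (f z))\<^sup>2)"
      by (intro AE_I2 tendsto_intros tendsto_uniform_limitI[OF s(2)]) simp
    show "(\<integral>\<^sup>+z. ennreal (B\<^sup>2) \<partial>\<mu> u) < \<infinity>"
      by (simp add: ennreal_mult_less_top)
  qed measurable
  ultimately show ?thesis
    unfolding sint_norm[OF s(1)] by (rule LIMSEQ_unique)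
qed

lemma bint_simple:
  assumes "simple_function M s"
  shows "bint s = sint s"
  using LIMSEQ_unique[OF sint_tendsto[of "\<lambda>_. s", OF assms uniform_limit_const] tendsto_const] .

lemma bint_add:
  assumes f: "bounded_borel f" and g: "bounded_borel g"
  shows "bint (\<lambda>z. f z + g z) = bint f + bint g"
proof -
  obtain s where s: "\<And>n. simple_function M (s n)" "uniform_limit \<Omega> s f sequentially"
    using bounded_borel_approx[OF f] by metis
  obtain t where t: "\<And>n. simple_function M (t n)" "uniform_limit \<Omega> t g sequentially"
    using bounded_borel_approx[OF g] by metis
  have "(\<lambda>n. sint (\<lambda>z. s n z + t n z)) \<longlonglongrightarrow> bint (\<lambda>z. f z + g z)"
    using s t by (intro sint_tendsto uniform_limit_add) auto
  moreover have "(\<lambda>n. sint (\<lambda>z. s n z + t n z)) \<longlonglongrightarrow> bint f + bint g"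
    using s t by (simp add: sint_add) (intro tendsto_add sint_tendsto)
  ultimately show ?thesis by (rule LIMSEQ_unique)
qed

lemma bint_mult:
  assumes f: "bounded_borel f" and g: "bounded_borel g"
  shows "bint (\<lambda>z. f z * g z) = bint f o\<^sub>L bint g"
proof -
  obtain s where s: "\<And>n. simple_function M (s n)" "uniform_limit \<Omega> s f sequentially"
    using bounded_borel_approx[OF f] by metis
  obtain t where t: "\<And>n. simple_function M (t n)" "uniform_limit \<Omega> t g sequentially"
    using bounded_borel_approx[OF g] by metis
  have "(\<lambda>n. sint (\<lambda>z. s n z * t n z)) \<longlonglongrightarrow> bint (\<lambda>z. f z * g z)"
    using s t f g by (intro sint_tendsto uniform_lim_mult bounded_borel_bounded) auto
  moreover have "(\<lambda>n. sint (\<lambda>z. s n z * t n z)) \<longlonglongrightarrow> (bint f o\<^sub>L bint g)"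
    using s t by (simp add: sint_mult)
      (intro bounded_bilinear.tendsto[OF bounded_bilinear_blinfun_compose] sint_tendsto)
  ultimately show ?thesis by (rule LIMSEQ_unique)
qed

lemma bounded_borel_const: "bounded_borel (\<lambda>_. c)"
  by (rule bounded_borelI[of _ "norm c"]) auto

lemma bounded_borel_add:
  assumes "bounded_borel f" "bounded_borel g"
  shows "bounded_borel (\<lambda>z. f z + g z)"
proof -
  from assms obtain B C where "\<And>z. z \<in> \<Omega> \<Longrightarrow> norm (f z) \<le> B" "\<And>z. z \<in> \<Omega> \<Longrightarrow> norm (g z) \<le> C"
    and [measurable]: "f \<in> borel_measurable M" "g \<in> borel_measurable M"
    unfolding bounded_borel_def by blast
  then show ?thesis
    by (intro bounded_borelI[of _ "B + C"] borel_measurable_add)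
      (auto intro: order_trans[OF norm_triangle_ineq] add_mono)
qed

lemma bounded_borel_mult:
  assumes "bounded_borel f" "bounded_borel g"
  shows "bounded_borel (\<lambda>z. f z * g z)"
proof -
  from assms obtain B C where "\<And>z. z \<in> \<Omega> \<Longrightarrow> norm (f z) \<le> B" "\<And>z. z \<in> \<Omega> \<Longrightarrow> norm (g z) \<le> C"
    and [measurable]: "f \<in> borel_measurable M" "g \<in> borel_measurable M"
    unfolding bounded_borel_def by blast
  then show ?thesis
    by (intro bounded_borelI[of _ "B * C"] borel_measurable_times)
      (auto simp: norm_mult intro!: mult_mono order_trans[OF norm_ge_zero])
qed

lemma bint_const: "bint (\<lambda>_. q) = L q"
proof -
  have "(\<lambda>_. q) ` \<Omega> = {q}" "(\<lambda>_. q) -` {q} \<inter> \<Omega> = \<Omega>"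
    using half_plane_nonempty by auto
  then have "sint (\<lambda>_. q) = L q"
    by (intro blinfun_eqI) (simp add: iq_integral_simple_def)
  then show ?thesis by (simp add: bint_simple)
qed

lemma bint_diff:
  assumes f: "bounded_borel f" and g: "bounded_borel g"
  shows "bint (\<lambda>z. f z - g z) = bint f - bint g"
proof -
  have "bounded_borel (\<lambda>z. -1 * g z)"
    using g by (intro bounded_borel_mult bounded_borel_const)
  then have "bint (\<lambda>z. (f z + -1 * g z) + g z) = bint (\<lambda>z. f z + -1 * g z) + bint g"
    by (intro bint_add bounded_borel_add f g)
  then show ?thesis by simp
qed

lemma bint_indicator:
  assumes E: "E \<in> sets M"
  shows "bint (\<lambda>z. if z \<in> E then 1 else 0) = Q E"
proof -
  let ?s = "\<lambda>z. if z \<in> E then 1 else 0 :: quat"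
  have meas: "?s \<in> borel_measurable M"
    by (intro measurable_If_set) (use E in auto)
  have "?s ` \<Omega> \<subseteq> {0, 1}" by auto
  then have s: "simple_function M ?s"
    using meas finite_subset by (intro simple_function_borel_measurable) auto
  \<comment> \<open>One of the two values may not be attained; its level set is then empty and
    contributes nothing.\<close>
  have "sint ?s = (\<Sum>p\<in>{0, 1}. L p o\<^sub>L Q (?s -` {p} \<inter> \<Omega>))"
    unfolding iq_integral_simple_def
  proof (rule sum.mono_neutral_left)
    show "\<forall>p\<in>{0, 1} - ?s ` \<Omega>. L p o\<^sub>L Q (?s -` {p} \<inter> \<Omega>) = 0"
    proof
      fix p assume "p \<in> {0, 1} - ?s ` \<Omega>"
      then have "?s -` {p} \<inter> \<Omega> = {}" by auto
      then show "L p o\<^sub>L Q (?s -` {p} \<inter> \<Omega>) = 0"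
        by simp
    qed
  qed auto
  also have "\<dots> = Q (?s -` {1} \<inter> \<Omega>)"
    by (intro blinfun_eqI) (simp add: L_0 L_1 blinfun.add_left)
  also have "?s -` {1} \<inter> \<Omega> = E"
    using E sets.sets_into_space[OF E] by auto
  finally show ?thesis
    by (simp add: bint_simple[OF s])
qed

lemma bounded_borel_indicator:
  assumes "E \<in> sets M"
  shows "bounded_borel (\<lambda>z. if z \<in> E then 1 else 0)"
  by (rule bounded_borelI[of _ 1]) (use assms in \<open>auto intro!: measurable_If_set\<close>)

end

section \<open>Integrals of unbounded functions\<close>

context iqpvm_space
begin

text \<open>The squared L2 norm for the spectral measure of u, kept in \<open>ennreal\<close> so
  that finiteness is membership in the domain of the integral.\<close>

definition energy :: "(quat \<Rightarrow> quat) \<Rightarrow> 'h \<Rightarrow> ennreal" where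
  "energy f u = (\<integral>\<^sup>+z. ennreal ((norm (f z))\<^sup>2) \<partial>\<mu> u)"

definition trunc :: "nat \<Rightarrow> (quat \<Rightarrow> quat) \<Rightarrow> quat \<Rightarrow> quat" where
  "trunc n f z = (if norm (f z) \<le> real n then f z else 0)"

text \<open>The value of the integral separated from its domain: a total function, meaningful where
  \<open>energy\<close> is finite.\<close>

definition int_vec :: "(quat \<Rightarrow> quat) \<Rightarrow> 'h \<Rightarrow> 'h" where
  "int_vec f u = lim (\<lambda>n. blinfun_apply (bint (trunc n f)) u)"

abbreviation int_op :: "(quat \<Rightarrow> quat) \<Rightarrow> 'h qop" where
  "int_op \<equiv> iq_integral \<iota> Q L"

lemma int_op_eq: "int_op f u = (if energy f u < \<infinity> then Some (int_vec f u) else None)"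
  by (simp add: iq_integral_def energy_def int_vec_def trunc_def[abs_def])

lemma measurable_ident_M [measurable]: "(\<lambda>z. z) \<in> borel_measurable M"
  by (intro measurable_restrict_space1) simp

lemma measurable_trunc [measurable]:
  assumes [measurable]: "f \<in> borel_measurable M"
  shows "trunc n f \<in> borel_measurable M"
  unfolding trunc_def[abs_def] by measurable

lemma bounded_borel_trunc:
  assumes [measurable]: "f \<in> borel_measurable M"
  shows "bounded_borel (trunc n f)"
  by (rule bounded_borelI[of _ "real n"]) (auto simp: trunc_def)

text \<open>A substitute for the triangle inequality in L2, strong enough for finiteness and for
  limits. The factors 2 come from (x + y)^2 \<le> 2x^2 + 2y^2.\<close>

lemma energy_mono_affine:
  assumes [measurable]: "f \<in> borel_measurable M" "g \<in> borel_measurable M" "h \<in> borel_measurable M"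
    and le: "\<And>z. z \<in> \<Omega> \<Longrightarrow> norm (f z) \<le> a * norm (g z) + b * norm (h z)" and "0 \<le> a" "0 \<le> b"
  shows "energy f u \<le> ennreal (2 * a\<^sup>2) * energy g u + ennreal (2 * b\<^sup>2) * energy h u"
proof -
  have "energy f u \<le> (\<integral>\<^sup>+z. ennreal (2 * a\<^sup>2) * ennreal ((norm (g z))\<^sup>2)
      + ennreal (2 * b\<^sup>2) * ennreal ((norm (h z))\<^sup>2) \<partial>\<mu> u)"
    unfolding energy_def
  proof (rule nn_integral_mono)
    fix z assume "z \<in> space (\<mu> u)"
    then have "(norm (f z))\<^sup>2 \<le> (a * norm (g z) + b * norm (h z))\<^sup>2"
      using le by (intro power_mono) auto
    also have "\<dots> \<le> 2 * a\<^sup>2 * (norm (g z))\<^sup>2 + 2 * b\<^sup>2 * (norm (h z))\<^sup>2"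
      using sum_squares_bound[of "a * norm (g z)" "b * norm (h z)"]
      by (simp add: power2_sum power_mult_distrib)
    finally show "ennreal ((norm (f z))\<^sup>2) \<le> ennreal (2 * a\<^sup>2) * ennreal ((norm (g z))\<^sup>2)
      + ennreal (2 * b\<^sup>2) * ennreal ((norm (h z))\<^sup>2)"
      by (simp flip: ennreal_mult ennreal_plus)
  qed
  also have "\<dots> = ennreal (2 * a\<^sup>2) * energy g u + ennreal (2 * b\<^sup>2) * energy h u"
    unfolding energy_def by (simp add: nn_integral_add nn_integral_cmult)
  finally show ?thesis .
qed

lemma energy_const: "energy (\<lambda>_. c) u = ennreal ((norm c * norm u)\<^sup>2)"
  by (simp add: energy_def power_mult_distrib ennreal_mult)

lemma energy_finite_affine:
  assumes "f \<in> borel_measurable M" "g \<in> borel_measurable M" "h \<in> borel_measurable M"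
    and "\<And>z. z \<in> \<Omega> \<Longrightarrow> norm (f z) \<le> a * norm (g z) + b * norm (h z)" and "0 \<le> a" "0 \<le> b"
    and "energy g u < \<infinity>" "energy h u < \<infinity>"
  shows "energy f u < \<infinity>"
  using energy_mono_affine[OF assms(1-6), of u] assms(7,8)
  by (auto simp: ennreal_mult_less_top elim!: order.strict_trans1)

lemma energy_add_finite:
  assumes "f \<in> borel_measurable M" "g \<in> borel_measurable M" "energy f u < \<infinity>" "energy g u < \<infinity>"
  shows "energy (\<lambda>z. f z + g z) u < \<infinity>"
  by (rule energy_finite_affine[OF _ assms(1,2) _ _ _ assms(3,4), of _ 1 1])
    (use assms in \<open>auto simp: norm_triangle_ineq\<close>)

lemma energy_tendsto_0:
  assumes [measurable]: "\<And>n. g n \<in> borel_measurable M" "f \<in> borel_measurable M"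
    and f: "energy f u < \<infinity>"
    and le: "\<And>n z. norm (g n z) \<le> norm (f z)" and lim: "\<And>z. (\<lambda>n. g n z) \<longlonglongrightarrow> 0"
  shows "(\<lambda>n. energy (g n) u) \<longlonglongrightarrow> 0"
proof -
  have "(\<lambda>n. energy (g n) u) \<longlonglongrightarrow> (\<integral>\<^sup>+z. ennreal ((norm (0::quat))\<^sup>2) \<partial>\<mu> u)"
    unfolding energy_def
  proof (rule nn_integral_dominated_convergence[where w = "\<lambda>z. ennreal ((norm (f z))\<^sup>2)"])
    show "AE z in \<mu> u. ennreal ((norm (g n z))\<^sup>2) \<le> ennreal ((norm (f z))\<^sup>2)" for n
      using le by (intro AE_I2 ennreal_leI power_mono) auto
    show "AE z in \<mu> u. (\<lambda>n. ennreal ((norm (g n z))\<^sup>2)) \<longlonglongrightarrow> ennreal ((norm (0::quat))\<^sup>2)"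
      by (intro AE_I2 tendsto_ennrealI tendsto_power tendsto_norm lim)
  qed (use f in \<open>auto simp: energy_def\<close>)
  then show ?thesis by simp
qed

lemma trunc_eventually: "\<forall>\<^sub>F n in sequentially. trunc n f z = f z"
proof -
  obtain N :: nat where "norm (f z) \<le> N"
    using real_arch_simple by blast
  then show ?thesis
    unfolding eventually_sequentially trunc_def
    by (intro exI[of _ N]) (auto intro: order_trans)
qed

lemma trunc_diff_tendsto_0: "(\<lambda>n. trunc n f z - f z) \<longlonglongrightarrow> 0"
  by (rule tendsto_eventually, rule eventually_mono[OF trunc_eventually]) simp

lemma energy_trunc_tendsto:
  assumes [measurable]: "f \<in> borel_measurable M" and f: "energy f u < \<infinity>"
  shows "(\<lambda>n. energy (\<lambda>z. trunc n f z - f z) u) \<longlonglongrightarrow> 0"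
  by (rule energy_tendsto_0[OF _ _ f])
    (use trunc_diff_tendsto_0 in \<open>auto simp: trunc_def\<close>)

lemma bint_norm: "bounded_borel f \<Longrightarrow> ennreal ((norm (blinfun_apply (bint f) u))\<^sup>2) = energy f u"
  unfolding energy_def by (rule bint_norm_nn_integral)

text \<open>As with simple functions, comparing two approximating sequences covers both the Cauchy
  property and independence of the sequence.\<close>

lemma bint_close:
  assumes f[measurable]: "f \<in> borel_measurable M"
    and g: "\<And>n. bounded_borel (g n)" "(\<lambda>n. energy (\<lambda>z. g n z - f z) u) \<longlonglongrightarrow> 0"
    and h: "\<And>n. bounded_borel (h n)" "(\<lambda>n. energy (\<lambda>z. h n z - f z) u) \<longlonglongrightarrow> 0"
    and e: "e > 0"
  shows "\<exists>N. \<forall>n\<ge>N. \<forall>m\<ge>N. norm (blinfun_apply (bint (g n)) u - blinfun_apply (bint (h m)) u) < e"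
proof -
  have [measurable]: "g n \<in> borel_measurable M" "h n \<in> borel_measurable M" for n
    using g(1) h(1) bounded_borel_measurable by auto
  \<comment> \<open>\<open>energy_mono_affine\<close> doubles each of the two errors, so e^2/8 gives
    a total of e^2/2, below e^2.\<close>
  have c: "ennreal (e\<^sup>2 / 8) > 0"
    using e by simp
  obtain N N' where N: "\<And>n. n \<ge> N \<Longrightarrow> energy (\<lambda>z. g n z - f z) u < ennreal (e\<^sup>2 / 8)"
    and N': "\<And>n. n \<ge> N' \<Longrightarrow> energy (\<lambda>z. h n z - f z) u < ennreal (e\<^sup>2 / 8)"
    using order_tendstoD(2)[OF g(2) c] order_tendstoD(2)[OF h(2) c]
    unfolding eventually_sequentially by metis
  have "norm (blinfun_apply (bint (g n)) u - blinfun_apply (bint (h m)) u) < e"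
    if "n \<ge> max N N'" "m \<ge> max N N'" for n m
  proof -
    have "ennreal ((norm (blinfun_apply (bint (g n)) u - blinfun_apply (bint (h m)) u))\<^sup>2) =
        energy (\<lambda>z. g n z - h m z) u"
    proof -
      have "bounded_borel (\<lambda>z. g n z + -1 * h m z)"
        by (intro bounded_borel_add bounded_borel_mult bounded_borel_const g h)
      then have "bounded_borel (\<lambda>z. g n z - h m z)" by simp
      then show ?thesis
        using bint_norm[of "\<lambda>z. g n z - h m z" u] g h by (simp add: bint_diff blinfun.diff_left)
    qed
    also have "\<dots> \<le> ennreal (2 * 1\<^sup>2) * energy (\<lambda>z. g n z - f z) u
        + ennreal (2 * 1\<^sup>2) * energy (\<lambda>z. h m z - f z) u"
    proof (rule energy_mono_affine)
      fix z
      show "norm (g n z - h m z) \<le> 1 * norm (g n z - f z) + 1 * norm (h m z - f z)"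
        using dist_triangle2[of "g n z" "h m z" "f z"] by (simp add: dist_norm)
    qed measurable
    also have "\<dots> \<le> ennreal (2 * 1\<^sup>2) * ennreal (e\<^sup>2 / 8) + ennreal (2 * 1\<^sup>2) * ennreal (e\<^sup>2 / 8)"
      using N[of n] N'[of m] that by (intro add_mono mult_left_mono less_imp_le) auto
    also have "\<dots> = ennreal (2 * 1\<^sup>2 * (e\<^sup>2 / 8) + 2 * 1\<^sup>2 * (e\<^sup>2 / 8))"
    proof -
      have *: "ennreal a * ennreal b + ennreal a * ennreal b = ennreal (a * b + a * b)"
        if "0 \<le> a" "0 \<le> b" for a b
        using that by (subst ennreal_plus) (simp_all add: ennreal_mult)
      show ?thesis by (rule *) simp_all
    qed
    also have "\<dots> = ennreal (e\<^sup>2 / 2)"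
      by simp
    finally have "(norm (blinfun_apply (bint (g n)) u - blinfun_apply (bint (h m)) u))\<^sup>2 \<le> e\<^sup>2 / 2"
      by (simp add: ennreal_le_iff)
    also have "\<dots> < e\<^sup>2"
      using e by simp
    finally show ?thesis
      using e by (simp add: power_less_imp_less_base)
  qed
  then show ?thesis by blast
qed

text \<open>Frees the integral from truncations: any bounded sequence converging in L2 will do. Sums
  and products of truncations are not truncations of the sum or product, so this is needed for the
  algebraic rules.\<close>

lemma int_vec_tendsto:
  assumes f: "f \<in> borel_measurable M" "energy f u < \<infinity>"
    and g: "\<And>n. bounded_borel (g n)" "(\<lambda>n. energy (\<lambda>z. g n z - f z) u) \<longlonglongrightarrow> 0"
  shows "(\<lambda>n. blinfun_apply (bint (g n)) u) \<longlonglongrightarrow> int_vec f u"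
proof -
  note t = bounded_borel_trunc[OF f(1)] energy_trunc_tendsto[OF f]
  have "Cauchy (\<lambda>n. blinfun_apply (bint (trunc n f)) u)"
    by (rule CauchyI) (rule bint_close[OF f(1) t t])
  then have "convergent (\<lambda>n. blinfun_apply (bint (trunc n f)) u)"
    by (simp add: Cauchy_convergent_iff)
  then have lim: "(\<lambda>n. blinfun_apply (bint (trunc n f)) u) \<longlonglongrightarrow> int_vec f u"
    unfolding int_vec_def by (simp add: convergent_LIMSEQ_iff)
  have "(\<lambda>n. blinfun_apply (bint (g n)) u - blinfun_apply (bint (trunc n f)) u) \<longlonglongrightarrow> 0"
  proof (rule LIMSEQ_I)
    fix e :: real assume "e > 0"
    then show "\<exists>N. \<forall>n\<ge>N. norm (blinfun_apply (bint (g n)) u - blinfun_apply (bint (trunc n f)) u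
        - 0) < e"
      using bint_close[OF f(1) g t, of e] by auto
  qed
  from tendsto_add[OF this lim] show ?thesis by simp
qed

lemma int_vec_trunc_tendsto:
  assumes f: "f \<in> borel_measurable M" "energy f u < \<infinity>"
  shows "(\<lambda>n. blinfun_apply (bint (trunc n f)) u) \<longlonglongrightarrow> int_vec f u"
  by (intro int_vec_tendsto energy_trunc_tendsto bounded_borel_trunc f)

lemma int_vec_norm:
  assumes f[measurable]: "f \<in> borel_measurable M" and fin: "energy f u < \<infinity>"
  shows "ennreal ((norm (int_vec f u))\<^sup>2) = energy f u"
proof -
  have "(\<lambda>n. ennreal ((norm (blinfun_apply (bint (trunc n f)) u))\<^sup>2))
      \<longlonglongrightarrow> ennreal ((norm (int_vec f u))\<^sup>2)"
    by (intro tendsto_ennrealI tendsto_power tendsto_norm int_vec_trunc_tendsto assms)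
  moreover have "(\<lambda>n. energy (trunc n f) u) \<longlonglongrightarrow> energy f u"
    unfolding energy_def
  proof (rule nn_integral_dominated_convergence[where w = "\<lambda>z. ennreal ((norm (f z))\<^sup>2)"])
    show "AE z in \<mu> u. ennreal ((norm (trunc n f z))\<^sup>2) \<le> ennreal ((norm (f z))\<^sup>2)" for n
      by (intro AE_I2 ennreal_leI power_mono) (auto simp: trunc_def)
    show "AE z in \<mu> u. (\<lambda>n. ennreal ((norm (trunc n f z))\<^sup>2)) \<longlonglongrightarrow> ennreal ((norm (f z))\<^sup>2)"
      by (intro AE_I2 tendsto_ennrealI tendsto_power tendsto_norm tendsto_eventually
          trunc_eventually)
  qed (use fin in \<open>auto simp: energy_def\<close>)
  ultimately show ?thesis
    unfolding bint_norm[OF bounded_borel_trunc[OF f]] by (rule LIMSEQ_unique)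
qed

lemma energy_bounded_finite: "bounded_borel f \<Longrightarrow> energy f u < \<infinity>"
  by (simp flip: bint_norm)

lemma int_vec_bounded:
  assumes f: "bounded_borel f"
  shows "int_vec f u = blinfun_apply (bint f) u"
proof -
  have "(\<lambda>n. blinfun_apply (bint f) u) \<longlonglongrightarrow> int_vec f u"
    using f by (intro int_vec_tendsto bounded_borel_measurable energy_bounded_finite)
      (simp_all add: energy_const)
  then show ?thesis
    by (simp add: LIMSEQ_const_iff)
qed

lemma int_vec_const: "int_vec (\<lambda>_. c) u = blinfun_apply (L c) u"
  by (simp add: int_vec_bounded bounded_borel_const bint_const)

lemma int_vec_add:
  assumes f[measurable]: "f \<in> borel_measurable M" and "energy f u < \<infinity>"
    and g[measurable]: "g \<in> borel_measurable M" and "energy g u < \<infinity>"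
  shows "int_vec (\<lambda>z. f z + g z) u = int_vec f u + int_vec g u"
proof -
  have "(\<lambda>n. blinfun_apply (bint (\<lambda>z. trunc n f z + trunc n g z)) u) \<longlonglongrightarrow> int_vec (\<lambda>z. f z + g z) u"
  proof (rule int_vec_tendsto)
    show "energy (\<lambda>z. f z + g z) u < \<infinity>"
      using assms by (rule_tac energy_add_finite)
    let ?e = "\<lambda>n. ennreal (2 * 1\<^sup>2) * energy (\<lambda>z. trunc n f z - f z) u
        + ennreal (2 * 1\<^sup>2) * energy (\<lambda>z. trunc n g z - g z) u"
    have "?e \<longlonglongrightarrow> ennreal (2 * 1\<^sup>2) * 0 + ennreal (2 * 1\<^sup>2) * 0"
      by (intro tendsto_add ennreal_tendsto_cmult energy_trunc_tendsto assms) auto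
    then have lim: "?e \<longlonglongrightarrow> 0" by simp
    show "(\<lambda>n. energy (\<lambda>z. trunc n f z + trunc n g z - (f z + g z)) u) \<longlonglongrightarrow> 0"
    proof (rule tendsto_sandwich[OF _ _ tendsto_const lim])
      show "\<forall>\<^sub>F n in sequentially. energy (\<lambda>z. trunc n f z + trunc n g z - (f z + g z)) u \<le> ?e n"
      proof (intro always_eventually allI energy_mono_affine)
        fix n z
        show "norm (trunc n f z + trunc n g z - (f z + g z)) \<le> 1 * norm (trunc n f z - f z)
            + 1 * norm (trunc n g z - g z)"
          using norm_triangle_ineq[of "trunc n f z - f z" "trunc n g z - g z"]
          by (simp add: algebra_simps)
      qed auto
    qed simp
  qed (use bounded_borel_trunc bounded_borel_add f g in auto)
  moreover have "(\<lambda>n. blinfun_apply (bint (\<lambda>z. trunc n f z + trunc n g z)) u) \<longlonglongrightarrow> int_vec f u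
      + int_vec g u"
    unfolding bint_add[OF bounded_borel_trunc[OF f] bounded_borel_trunc[OF g]] blinfun.add_left
    by (intro tendsto_add int_vec_trunc_tendsto assms)
  ultimately show ?thesis by (rule LIMSEQ_unique)
qed

text \<open>The constant is obtained before f and u, since it must be uniform along sequences such
  as \<open>trunc n f - f\<close>. Its nonnegativity uses a point of the half plane.\<close>

lemma energy_bounded_mult_le:
  assumes h: "bounded_borel h"
  obtains B where "0 \<le> B"
    "\<And>f u. f \<in> borel_measurable M \<Longrightarrow> energy (\<lambda>z. h z * f z) u \<le> ennreal B * energy f u"
proof -
  from h obtain B where [measurable]: "h \<in> borel_measurable M" and B: "\<And>z. z \<in> \<Omega> \<Longrightarrow> norm (h z) \<le> B"
    unfolding bounded_borel_def by blast
  have "0 \<le> B"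
    using B[OF half_plane_nonempty] norm_ge_zero order_trans by blast
  have "energy (\<lambda>z. h z * f z) u \<le> ennreal (2 * B\<^sup>2) * energy f u"
    if [measurable]: "f \<in> borel_measurable M" for f u
  proof -
    have "energy (\<lambda>z. h z * f z) u \<le> ennreal (2 * B\<^sup>2) * energy f u
        + ennreal (2 * 0\<^sup>2) * energy f u"
      using B \<open>0 \<le> B\<close> by (intro energy_mono_affine) (auto simp: norm_mult intro: mult_right_mono)
    then show ?thesis by simp
  qed
  then show thesis by (intro that[of "2 * B\<^sup>2"]) auto
qed

lemma energy_bounded_mult_finite:
  assumes h: "bounded_borel h" and f: "f \<in> borel_measurable M" "energy f u < \<infinity>"
  shows "energy (\<lambda>z. h z * f z) u < \<infinity>"
proof -
  obtain B where "energy (\<lambda>z. h z * f z) u \<le> ennreal B * energy f u"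
    using energy_bounded_mult_le[OF h] f(1) by metis
  also have "\<dots> < \<infinity>"
    using f(2) by (simp add: ennreal_mult_less_top)
  finally show ?thesis .
qed

lemma int_vec_bounded_mult:
  assumes h: "bounded_borel h" and f[measurable]: "f \<in> borel_measurable M" and fin: "energy f u < \<infinity>"
  shows "int_vec (\<lambda>z. h z * f z) u = blinfun_apply (bint h) (int_vec f u)"
proof -
  note [measurable] = bounded_borel_measurable[OF h]
  have "(\<lambda>n. blinfun_apply (bint (\<lambda>z. h z * trunc n f z)) u) \<longlonglongrightarrow> int_vec (\<lambda>z. h z * f z) u"
  proof (rule int_vec_tendsto)
    obtain B where B: "\<And>g v. g \<in> borel_measurable M \<Longrightarrow> energy (\<lambda>z. h z * g z) v
        \<le> ennreal B * energy g v"
      using energy_bounded_mult_le[OF h] by metis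
    have "(\<lambda>n. ennreal B * energy (\<lambda>z. trunc n f z - f z) u) \<longlonglongrightarrow> ennreal B * 0"
      by (intro ennreal_tendsto_cmult energy_trunc_tendsto f fin) auto
    then have lim: "(\<lambda>n. ennreal B * energy (\<lambda>z. trunc n f z - f z) u) \<longlonglongrightarrow> 0" by simp
    show "(\<lambda>n. energy (\<lambda>z. h z * trunc n f z - h z * f z) u) \<longlonglongrightarrow> 0"
      by (rule tendsto_sandwich[OF _ _ tendsto_const lim])
        (auto simp flip: right_diff_distrib intro!: always_eventually B)
  qed (use bounded_borel_trunc bounded_borel_mult energy_bounded_mult_finite h f fin in auto)
  moreover have "(\<lambda>n. blinfun_apply (bint (\<lambda>z. h z * trunc n f z)) u)
      \<longlonglongrightarrow> blinfun_apply (bint h) (int_vec f u)"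
    unfolding bint_mult[OF h bounded_borel_trunc[OF f]] blinfun_apply_blinfun_compose
    by (intro blinfun.tendsto tendsto_const int_vec_trunc_tendsto f fin)
  ultimately show ?thesis by (rule LIMSEQ_unique)
qed

lemma int_vec_cmult:
  assumes "f \<in> borel_measurable M" "energy f u < \<infinity>"
  shows "int_vec (\<lambda>z. c * f z) u = blinfun_apply (L c) (int_vec f u)"
  using int_vec_bounded_mult[OF bounded_borel_const assms] by (simp add: bint_const)

lemma int_vec_diff:
  assumes f: "f \<in> borel_measurable M" "energy f u < \<infinity>"
    and g: "g \<in> borel_measurable M" "energy g u < \<infinity>"
  shows "energy (\<lambda>z. f z - g z) u < \<infinity>" "int_vec (\<lambda>z. f z - g z) u = int_vec f u - int_vec g u"
proof -
  have m: "(\<lambda>z. -1 * g z) \<in> borel_measurable M" "energy (\<lambda>z. -1 * g z) u < \<infinity>"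
    using energy_bounded_mult_finite[OF bounded_borel_const g, of "-1"] g(1)
        by (simp_all add: energy_def)
  have "L (-1) = - id_blinfun"
    using L_scaleR_1[of "-1"] by simp
  then show "int_vec (\<lambda>z. f z - g z) u = int_vec f u - int_vec g u"
    using int_vec_add[OF f m] unfolding int_vec_cmult[OF g] by (simp add: blinfun.minus_left)
  show "energy (\<lambda>z. f z - g z) u < \<infinity>"
    using energy_add_finite[OF f(1) m(1) f(2) m(2)] by simp
qed

text \<open>Unlike in \<open>int_vec_tendsto\<close> the approximants may be unbounded; the isometry
  applied to the differences gives the claim.\<close>

lemma int_vec_continuous:
  assumes f: "f \<in> borel_measurable M" "energy f u < \<infinity>"
    and g: "\<And>n. g n \<in> borel_measurable M" "\<And>n. energy (g n) u < \<infinity>"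
    and lim: "(\<lambda>n. energy (\<lambda>z. g n z - f z) u) \<longlonglongrightarrow> 0"
  shows "(\<lambda>n. int_vec (g n) u) \<longlonglongrightarrow> int_vec f u"
proof -
  have "ennreal ((norm (int_vec (g n) u - int_vec f u))\<^sup>2) = energy (\<lambda>z. g n z - f z) u" for n
    using int_vec_norm[of "\<lambda>z. g n z - f z" u] int_vec_diff[OF g(1)[of n] g(2)[of n] f] f(1) g(1)
    by simp
  with lim have "(\<lambda>n. ennreal ((norm (int_vec (g n) u - int_vec f u))\<^sup>2)) \<longlonglongrightarrow> ennreal 0"
    by simp
  then have "(\<lambda>n. (norm (int_vec (g n) u - int_vec f u))\<^sup>2) \<longlonglongrightarrow> 0"
    by (subst (asm) tendsto_ennreal_iff) auto
  then have "(\<lambda>n. norm (int_vec (g n) u - int_vec f u)) \<longlonglongrightarrow> 0"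
    by simp
  then show ?thesis
    by (rule LIM_zero_cancel[OF tendsto_norm_zero_cancel])
qed

lemma energy_cong_AE:
  assumes "AE z in \<mu> u. f z = g z"
  shows "energy f u = energy g u"
  unfolding energy_def using assms by (intro nn_integral_cong_AE) auto

text \<open>The isometry sends the difference, which is null in L2, to 0.\<close>

lemma int_vec_cong_AE:
  assumes f: "f \<in> borel_measurable M" "energy f u < \<infinity>" and g: "g \<in> borel_measurable M"
    and ae: "AE z in \<mu> u. f z = g z"
  shows "int_vec f u = int_vec g u"
proof -
  have fin: "energy g u < \<infinity>"
    using energy_cong_AE[OF ae] f by simp
  have "energy (\<lambda>z. f z - g z) u = energy (\<lambda>_. 0) u"
    using ae by (intro energy_cong_AE) auto
  then have "ennreal ((norm (int_vec f u - int_vec g u))\<^sup>2) = 0"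
    using int_vec_norm[of "\<lambda>z. f z - g z" u] int_vec_diff[OF f g fin] f g
        by (simp add: energy_const)
  then show ?thesis by simp
qed

section \<open>Change of spectral measure and composition of integrals\<close>

lemma Q_int_vec:
  assumes "E \<in> sets M" "f \<in> borel_measurable M" "energy f u < \<infinity>"
  shows "blinfun_apply (Q E) (int_vec f u) = int_vec (\<lambda>z. (if z \<in> E then 1 else 0) * f z) u"
  using int_vec_bounded_mult[OF bounded_borel_indicator assms(2,3)] assms(1)
  by (simp add: bint_indicator)

text \<open>\<open>Q E\<close> multiplies the integrand by the indicator of E, and the isometry
  turns the norm of the result into the integral of |f|^2 over E.\<close>

lemma spectral_measure_int_vec:
  assumes f[measurable]: "f \<in> borel_measurable M" and fin: "energy f u < \<infinity>"
  shows "\<mu> (int_vec f u) = density (\<mu> u) (\<lambda>z. ennreal ((norm (f z))\<^sup>2))"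
proof (rule measure_eqI)
  fix E assume "E \<in> sets (\<mu> (int_vec f u))"
  then have E[measurable]: "E \<in> sets M" by simp
  let ?g = "\<lambda>z. (if z \<in> E then 1 else 0) * f z"
  have "?g \<in> borel_measurable M"
    using bounded_borel_measurable[OF bounded_borel_indicator[OF E]] by measurable
  then have "ennreal ((norm (int_vec ?g u))\<^sup>2) = energy ?g u"
    using energy_bounded_mult_finite[OF bounded_borel_indicator[OF E] f fin] by (rule int_vec_norm)
  then have "emeasure (\<mu> (int_vec f u)) E = energy ?g u"
    using E f fin by (simp add: emeasure_spectral_measure Q_int_vec)
  also have "\<dots> = (\<integral>\<^sup>+z. ennreal ((norm (f z))\<^sup>2) * indicator E z \<partial>\<mu> u)"
    unfolding energy_def by (intro nn_integral_cong) (auto simp: indicator_def)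
  also have "\<dots> = emeasure (density (\<mu> u) (\<lambda>z. ennreal ((norm (f z))\<^sup>2))) E"
    by (subst emeasure_density) auto
  finally show "emeasure (\<mu> (int_vec f u)) E
      = emeasure (density (\<mu> u) (\<lambda>z. ennreal ((norm (f z))\<^sup>2))) E" .
qed simp

text \<open>Identifies natural domains of compositions: finiteness at the image vector becomes
  finiteness of the product integrand at u.\<close>

lemma energy_int_vec:
  assumes f[measurable]: "f \<in> borel_measurable M" and fin: "energy f u < \<infinity>"
    and g[measurable]: "g \<in> borel_measurable M"
  shows "energy g (int_vec f u) = energy (\<lambda>z. g z * f z) u"
proof -
  have "energy g (int_vec f u) = (\<integral>\<^sup>+z. ennreal ((norm (f z))\<^sup>2) * ennreal ((norm (g z))\<^sup>2) \<partial>\<mu> u)"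
    unfolding energy_def spectral_measure_int_vec[OF f fin] by (rule nn_integral_density) auto
  also have "\<dots> = energy (\<lambda>z. g z * f z) u"
    unfolding energy_def
    by (intro nn_integral_cong) (simp add: norm_mult power_mult_distrib mult.commute flip:
        ennreal_mult)
  finally show ?thesis .
qed

text \<open>Only the outer function g is truncated, which is the bounded case. By the density
  formula, the L2 error at u of the truncated product is the error of truncating g at
  \<open>int_vec f u\<close>.\<close>

lemma int_vec_mult:
  assumes f[measurable]: "f \<in> borel_measurable M" and fin: "energy f u < \<infinity>"
    and g[measurable]: "g \<in> borel_measurable M" and gf: "energy (\<lambda>z. g z * f z) u < \<infinity>"
  shows "int_vec g (int_vec f u) = int_vec (\<lambda>z. g z * f z) u"
proof -
  have g': "energy g (int_vec f u) < \<infinity>"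
    using gf by (simp add: energy_int_vec[OF f fin g])
  have eq: "blinfun_apply (bint (trunc n g)) (int_vec f u) = int_vec (\<lambda>z. trunc n g z * f z) u"
      for n
    using int_vec_bounded_mult[OF bounded_borel_trunc[OF g] f fin] by simp
  have "(\<lambda>n. energy (\<lambda>z. trunc n g z * f z - g z * f z) u) \<longlonglongrightarrow> 0"
    using energy_trunc_tendsto[OF g g'] energy_int_vec[OF f fin]
    by (simp flip: left_diff_distrib)
  then have "(\<lambda>n. int_vec (\<lambda>z. trunc n g z * f z) u) \<longlonglongrightarrow> int_vec (\<lambda>z. g z * f z) u"
    using energy_bounded_mult_finite[OF bounded_borel_trunc[OF g] f fin] gf
    by (intro int_vec_continuous) auto
  moreover have "(\<lambda>n. int_vec (\<lambda>z. trunc n g z * f z) u) \<longlonglongrightarrow> int_vec g (int_vec f u)"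
    using int_vec_trunc_tendsto[OF g g'] unfolding eq .
  ultimately show ?thesis
    by (rule LIMSEQ_unique[symmetric])
qed

end

section \<open>Spectral calculus\<close>

context iqpvm_space
begin

lemma int_op_Some: "int_op f u = Some v \<longleftrightarrow> energy f u < \<infinity> \<and> v = int_vec f u"
  by (auto simp: int_op_eq)

lemma dom_int_op: "dom (int_op f) = {u. energy f u < \<infinity>}"
  by (auto simp: int_op_eq dom_def split: if_splits)

lemma measurable_level [measurable]:
  assumes "Measurable.pred M P"
  shows "{z\<in>\<Omega>. P z} \<in> sets M"
proof -
  have "{z\<in>space M. P z} \<in> sets M"
    using assms by measurable
  then show ?thesis by simp
qed

lemma Q_eq_0_subset:
  assumes "E \<in> sets M" "F \<in> sets M" "E \<subseteq> F" "Q F = 0"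
  shows "Q E = 0"
proof (rule blinfun_eqI)
  fix u
  show "blinfun_apply (Q E) u = blinfun_apply 0 u"
    using Q_Int[OF assms(1,2), of u] assms(3,4) by (simp add: Int_absorb2)
qed

lemma Q_decompose:
  assumes [measurable]: "Measurable.pred M P"
  shows "u = blinfun_apply (Q {z\<in>\<Omega>. P z}) u + blinfun_apply (Q {z\<in>\<Omega>. \<not> P z}) u"
proof -
  have "{z\<in>\<Omega>. P z} \<union> {z\<in>\<Omega>. \<not> P z} = \<Omega>" by auto
  moreover have "Q ({z\<in>\<Omega>. P z} \<union> {z\<in>\<Omega>. \<not> P z}) = Q {z\<in>\<Omega>. P z} + Q {z\<in>\<Omega>. \<not> P z}"
    by (rule Q_Un) auto
  ultimately show ?thesis
    by (metis Q_space blinfun.add_left id_blinfun.rep_eq)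
qed

lemma AE_of_Q_eq_0:
  assumes "Measurable.pred M P" "Q {z\<in>\<Omega>. \<not> P z} = 0"
  shows "AE z in \<mu> u. P z"
  using assms by (simp add: AE_spectral_measure_iff)

section \<open>Kernel and inverse of an integral\<close>

lemma int_op_eq_0_iff:
  assumes f[measurable]: "f \<in> borel_measurable M"
  shows "int_op f u = Some 0 \<longleftrightarrow> blinfun_apply (Q {z\<in>\<Omega>. f z \<noteq> 0}) u = 0"
proof -
  have "int_op f u = Some 0 \<longleftrightarrow> energy f u = 0"
    using int_vec_norm[OF f, of u] by (auto simp: int_op_Some)
  also have "\<dots> \<longleftrightarrow> (AE z in \<mu> u. f z = 0)"
    unfolding energy_def by (subst nn_integral_0_iff_AE) (auto simp: ennreal_eq_0_iff)
  also have "\<dots> \<longleftrightarrow> blinfun_apply (Q {z\<in>\<Omega>. f z \<noteq> 0}) u = 0"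
    by (rule AE_spectral_measure_iff) measurable
  finally show ?thesis .
qed

text \<open>The kernel is the range of the projection
  \<open>Q {z\<in>\<Omega>. f z = 0}\<close>.\<close>

lemma op_ker_int_op:
  assumes f[measurable]: "f \<in> borel_measurable M"
  shows "op_ker (int_op f) = {0} \<longleftrightarrow> Q {z\<in>\<Omega>. f z = 0} = 0"
proof
  assume ker: "op_ker (int_op f) = {0}"
  show "Q {z\<in>\<Omega>. f z = 0} = 0"
  proof (rule blinfun_eqI)
    fix u
    have "{z\<in>\<Omega>. f z \<noteq> 0} \<inter> {z\<in>\<Omega>. f z = 0} = {}" by auto
    then have "blinfun_apply (Q {z\<in>\<Omega>. f z \<noteq> 0}) (blinfun_apply (Q {z\<in>\<Omega>. f z = 0}) u) = 0"
      by (subst Q_Int) auto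
    then have "blinfun_apply (Q {z\<in>\<Omega>. f z = 0}) u \<in> op_ker (int_op f)"
      by (simp add: op_ker_def int_op_eq_0_iff)
    then show "blinfun_apply (Q {z\<in>\<Omega>. f z = 0}) u = blinfun_apply 0 u"
      using ker by simp
  qed
next
  assume "Q {z\<in>\<Omega>. f z = 0} = 0"
  then have "u = blinfun_apply (Q {z\<in>\<Omega>. f z \<noteq> 0}) u" for u
    using Q_decompose[of "\<lambda>z. f z = 0" u] by simp
  then show "op_ker (int_op f) = {0}"
    by (auto simp: op_ker_def int_op_eq_0_iff)
qed

text \<open>The product of 1/f and f is 1 off the zero set of f, which is null for the spectral
  measure of every vector.\<close>

lemma int_op_inverse_Some:
  assumes f[measurable]: "f \<in> borel_measurable M" and null: "Q {z\<in>\<Omega>. f z = 0} = 0"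
    and uv: "int_op f u = Some v"
  shows "int_op (\<lambda>z. inverse (f z)) v = Some u"
proof -
  from uv have fin: "energy f u < \<infinity>" and v: "v = int_vec f u"
    by (simp_all add: int_op_Some)
  have ae: "AE z in \<mu> u. inverse (f z) * f z = 1"
    using AE_of_Q_eq_0[of "\<lambda>z. f z \<noteq> 0" u] null by (auto elim: eventually_mono)
  have e: "energy (\<lambda>z. inverse (f z) * f z) u = energy (\<lambda>_. 1) u"
    by (rule energy_cong_AE[OF ae])
  have fin1: "energy (\<lambda>z. inverse (f z) * f z) u < \<infinity>"
    unfolding e by (simp add: energy_const)
  have "int_vec (\<lambda>z. inverse (f z)) v = int_vec (\<lambda>z. inverse (f z) * f z) u"
    unfolding v by (rule int_vec_mult[OF f fin _ fin1]) measurable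
  also have "\<dots> = int_vec (\<lambda>_. 1) u"
    by (rule int_vec_cong_AE[OF _ fin1 _ ae]) measurable
  also have "\<dots> = u"
    by (simp add: int_vec_const L_1)
  finally have "int_vec (\<lambda>z. inverse (f z)) v = u" .
  moreover have "energy (\<lambda>z. inverse (f z)) v < \<infinity>"
    unfolding v using fin1 by (subst energy_int_vec[OF f fin]) auto
  ultimately show ?thesis
    by (simp add: int_op_Some)
qed

lemma int_op_inverse_iff:
  assumes f[measurable]: "f \<in> borel_measurable M" and null: "Q {z\<in>\<Omega>. f z = 0} = 0"
  shows "int_op f u = Some v \<longleftrightarrow> int_op (\<lambda>z. inverse (f z)) v = Some u"
  \<comment> \<open>The converse applies the same lemma to 1/f: because
    \<open>inverse 0 = 0\<close>, it has the same zeros as f and its inverse is f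
    everywhere.\<close>
  using int_op_inverse_Some[OF f null, of u v]
    int_op_inverse_Some[of "\<lambda>z. inverse (f z)" v u] null by auto

lemma op_inverse_int_op:
  assumes f: "f \<in> borel_measurable M" and null: "Q {z\<in>\<Omega>. f z = 0} = 0"
  shows "op_inverse (int_op f) = int_op (\<lambda>z. inverse (f z))"
proof
  fix v
  show "op_inverse (int_op f) v = int_op (\<lambda>z. inverse (f z)) v"
  proof (cases "int_op (\<lambda>z. inverse (f z)) v")
    case None
    then have "v \<notin> ran (int_op f)"
      by (auto simp: ran_def int_op_inverse_iff[OF f null])
    with None show ?thesis by (simp add: op_inverse_def)
  next
    case (Some u)
    then have "v \<in> ran (int_op f)" "(THE u. int_op f u = Some v) = u"
      by (auto simp: ran_def int_op_inverse_iff[OF f null])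
    with Some show ?thesis by (simp add: op_inverse_def)
  qed
qed

section \<open>Ranges, dense domains and norm bounds\<close>

lemma ran_int_op:
  assumes f: "f \<in> borel_measurable M" and null: "Q {z\<in>\<Omega>. f z = 0} = 0"
  shows "ran (int_op f) = dom (int_op (\<lambda>z. inverse (f z)))"
  unfolding ran_def dom_def int_op_inverse_iff[OF f null] by auto

text \<open>A local bound: u lies in the range of the projection onto P, so only values of f on P
  count. The choices of P below are |f| \<le> n for density, |f| \<ge> \<epsilon> for bounding 1/f,
  and |f| < \<epsilon> for extracting a gap.\<close>

lemma bounded_image_Q:
  assumes f[measurable]: "f \<in> borel_measurable M" and [measurable]: "Measurable.pred M P"
    and C: "0 \<le> C" "\<And>z. z \<in> \<Omega> \<Longrightarrow> P z \<Longrightarrow> norm (f z) \<le> C"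
    and u: "blinfun_apply (Q {z\<in>\<Omega>. \<not> P z}) u = 0"
  shows "energy f u < \<infinity>" "norm (int_vec f u) \<le> C * norm u"
proof -
  have "AE z in \<mu> u. P z"
    using u by (simp add: AE_spectral_measure_iff)
  then have "AE z in \<mu> u. ennreal ((norm (f z))\<^sup>2) \<le> ennreal (C\<^sup>2)"
    using AE_space by eventually_elim (use C in \<open>auto intro!: ennreal_leI power_mono\<close>)
  then have "energy f u \<le> (\<integral>\<^sup>+z. ennreal (C\<^sup>2) \<partial>\<mu> u)"
    unfolding energy_def by (rule nn_integral_mono_AE)
  also have "\<dots> = ennreal ((C * norm u)\<^sup>2)"
    by (simp add: power_mult_distrib ennreal_mult)
  finally have le: "energy f u \<le> ennreal ((C * norm u)\<^sup>2)" .
  then show fin: "energy f u < \<infinity>"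
    by (rule le_less_trans) simp
  from le have "(norm (int_vec f u))\<^sup>2 \<le> (C * norm u)\<^sup>2"
    by (simp flip: int_vec_norm[OF f fin])
  then show "norm (int_vec f u) \<le> C * norm u"
    by (rule power2_le_imp_le) (simp add: C(1))
qed

lemma Q_complement_Q:
  assumes [measurable]: "Measurable.pred M P"
  shows "blinfun_apply (Q {z\<in>\<Omega>. \<not> P z}) (blinfun_apply (Q {z\<in>\<Omega>. P z}) u) = 0"
proof -
  have "{z\<in>\<Omega>. \<not> P z} \<inter> {z\<in>\<Omega>. P z} = {}" by auto
  then show ?thesis by (subst Q_Int) auto
qed

text \<open>Cutting u off to the region |f| \<le> n puts it into the domain, and these cut-offs
  converge to u because the indicators tend to 1 in L2.\<close>

lemma dense_dom_int_op:
  assumes f[measurable]: "f \<in> borel_measurable M"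
  shows "closure (dom (int_op f)) = UNIV"
proof -
  have "u \<in> closure (dom (int_op f))" for u
    unfolding closure_sequential
  proof (intro exI conjI allI)
    let ?P = "\<lambda>n z. norm (f z) \<le> real n"
    let ?s = "\<lambda>n z. if z \<in> {z\<in>\<Omega>. ?P n z} then 1 else 0 :: quat"
    have E: "{z\<in>\<Omega>. ?P n z} \<in> sets M" for n
      by measurable
    show "blinfun_apply (Q {z\<in>\<Omega>. ?P n z}) u \<in> dom (int_op f)" for n
      unfolding dom_int_op
      using bounded_image_Q(1)[OF f, of "?P n" "real n"] Q_complement_Q[of "?P n" u] by simp
    note [measurable] = bounded_borel_measurable[OF bounded_borel_indicator[OF E]]
    have "(\<lambda>n. blinfun_apply (bint (?s n)) u) \<longlonglongrightarrow> int_vec (\<lambda>_. 1) u"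
    proof (rule int_vec_tendsto)
      \<comment> \<open>\<open>energy_tendsto_0\<close> asks for convergence at every quaternion,
        while \<open>?s n z - 1\<close> stays -1 off the half plane; this integrand agrees with it
        on the half plane and tends to 0 everywhere.\<close>
      have "(\<lambda>n. energy (\<lambda>z. if norm (f z) \<le> real n then 0 else - 1) u) \<longlonglongrightarrow> 0"
      proof (rule energy_tendsto_0[where f = "\<lambda>_. 1"])
        fix z
        obtain N :: nat where "norm (f z) \<le> N"
          using real_arch_simple by blast
        then have "\<forall>\<^sub>F n in sequentially. norm (f z) \<le> real n"
          unfolding eventually_sequentially by (intro exI[of _ N]) (auto intro: order_trans)
        then show "(\<lambda>n. if norm (f z) \<le> real n then 0 else - 1 :: quat) \<longlonglongrightarrow> 0"
          by (intro tendsto_eventually) (auto elim: eventually_mono)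
      qed (auto simp: energy_const)
      moreover have "energy (\<lambda>z. ?s n z - 1) u = energy (\<lambda>z. if norm (f z)
          \<le> real n then 0 else - 1) u" for n
        unfolding energy_def by (intro nn_integral_cong) auto
      ultimately show "(\<lambda>n. energy (\<lambda>z. ?s n z - 1) u) \<longlonglongrightarrow> 0"
        by simp
    qed (use bounded_borel_indicator[OF E] in \<open>simp_all add: energy_const\<close>)
    then show "(\<lambda>n. blinfun_apply (Q {z\<in>\<Omega>. ?P n z}) u) \<longlonglongrightarrow> u"
      unfolding bint_indicator[OF E] by (simp add: int_vec_const L_1)
  qed
  then show ?thesis by blast
qed

text \<open>The range is the domain of the integral of 1/f, and every such domain is dense.\<close>

lemma dense_ran_int_op:
  assumes "f \<in> borel_measurable M" "Q {z\<in>\<Omega>. f z = 0} = 0"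
  shows "closure (ran (int_op f)) = UNIV"
  using assms by (simp add: ran_int_op dense_dom_int_op borel_measurable_inverse)

lemma inverse_bounded_of_gap:
  assumes f[measurable]: "f \<in> borel_measurable M" and \<epsilon>: "\<epsilon> > 0" "Q {z\<in>\<Omega>. norm (f z) < \<epsilon>} = 0"
  shows "energy (\<lambda>z. inverse (f z)) u < \<infinity>"
    "norm (int_vec (\<lambda>z. inverse (f z)) u) \<le> inverse \<epsilon> * norm u"
proof -
  have "{z\<in>\<Omega>. \<not> \<epsilon> \<le> norm (f z)} = {z\<in>\<Omega>. norm (f z) < \<epsilon>}" by auto
  then have u: "blinfun_apply (Q {z\<in>\<Omega>. \<not> \<epsilon> \<le> norm (f z)}) u = 0"
    using \<epsilon> by simp
  have b: "norm (inverse (f z)) \<le> inverse \<epsilon>" if "\<epsilon> \<le> norm (f z)" for z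
    using that \<epsilon> by (simp add: norm_inverse le_imp_inverse_le)
  show "energy (\<lambda>z. inverse (f z)) u < \<infinity>"
    "norm (int_vec (\<lambda>z. inverse (f z)) u) \<le> inverse \<epsilon> * norm u"
    using bounded_image_Q[of "\<lambda>z. inverse (f z)" "\<lambda>z. \<epsilon> \<le> norm (f z)" "inverse \<epsilon>" u] b u \<epsilon> by auto
qed

lemma Q_zero_of_gap:
  assumes [measurable]: "f \<in> borel_measurable M" and "\<epsilon> > 0" "Q {z\<in>\<Omega>. norm (f z) < \<epsilon>} = 0"
  shows "Q {z\<in>\<Omega>. f z = 0} = 0"
  by (rule Q_eq_0_subset[OF _ _ _ assms(3)]) (use assms(2) in auto)

lemma op_bounded_inverse_int_op:
  assumes f[measurable]: "f \<in> borel_measurable M" and null: "Q {z\<in>\<Omega>. f z = 0} = 0"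
  shows "op_bounded (op_inverse (int_op f)) \<longleftrightarrow> (\<exists>\<epsilon>>0. Q {z\<in>\<Omega>. norm (f z) < \<epsilon>} = 0)"
proof
  assume "op_bounded (op_inverse (int_op f))"
  then obtain K where K: "\<And>u v. int_op f u = Some v \<Longrightarrow> norm u \<le> K * norm v"
    by (auto simp: op_inverse_int_op[OF f null] op_bounded_def int_op_inverse_iff[OF f null])
  \<comment> \<open>Chosen with |K| \<epsilon> < 1: a vector supported on |f| < \<epsilon> then has
    norm at most |K| \<epsilon> times its own norm, hence is 0.\<close>
  define \<epsilon> where "\<epsilon> = 1 / (\<bar>K\<bar> + 1)"
  have \<epsilon>: "\<epsilon> > 0" "\<bar>K\<bar> * \<epsilon> < 1"
    by (simp_all add: \<epsilon>_def field_simps)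
  have "Q {z\<in>\<Omega>. norm (f z) < \<epsilon>} = 0"
  proof (rule blinfun_eqI)
    fix w
    let ?u = "blinfun_apply (Q {z\<in>\<Omega>. norm (f z) < \<epsilon>}) w"
    have u: "energy f ?u < \<infinity>" "norm (int_vec f ?u) \<le> \<epsilon> * norm ?u"
      using bounded_image_Q[OF f, of "\<lambda>z. norm (f z) < \<epsilon>" \<epsilon> ?u]
        Q_complement_Q[of "\<lambda>z. norm (f z) < \<epsilon>" w] \<epsilon> by auto
    have "norm ?u \<le> K * norm (int_vec f ?u)"
      using K u(1) by (simp add: int_op_Some)
    also have "\<dots> \<le> \<bar>K\<bar> * (\<epsilon> * norm ?u)"
      using u(2) by (intro mult_mono) auto
    finally have "(1 - \<bar>K\<bar> * \<epsilon>) * norm ?u \<le> 0"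
      by (simp add: algebra_simps)
    then have "norm ?u \<le> 0"
      using \<epsilon>(2) by (simp add: mult_le_0_iff)
    then show "?u = blinfun_apply 0 w" by simp
  qed
  with \<epsilon>(1) show "\<exists>\<epsilon>>0. Q {z\<in>\<Omega>. norm (f z) < \<epsilon>} = 0" by blast
next
  assume "\<exists>\<epsilon>>0. Q {z\<in>\<Omega>. norm (f z) < \<epsilon>} = 0"
  then obtain \<epsilon> where "\<epsilon> > 0" "Q {z\<in>\<Omega>. norm (f z) < \<epsilon>} = 0" by blast
  then show "op_bounded (op_inverse (int_op f))"
    unfolding op_inverse_int_op[OF f null] op_bounded_def
    using inverse_bounded_of_gap(2)[OF f] by (auto simp: int_op_Some)
qed

section \<open>The operator with spectral measure \<open>Q\<close>\<close>

abbreviation T :: "'h qop" where "T \<equiv> int_op (\<lambda>z. z)"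

lemma op_diff_L:
  "op_diff T (op_of (L q)) = int_op (\<lambda>z. z - q)"
proof
  fix u
  have m: "(\<lambda>z. z - q) \<in> borel_measurable M" by measurable
  have c: "energy (\<lambda>_. q) u < \<infinity>"
    by (simp add: energy_const)
  \<comment> \<open>A constant has finite energy at every vector, so subtracting it leaves the
    domain unchanged.\<close>
  have fin: "energy (\<lambda>z. z - q) u < \<infinity> \<longleftrightarrow> energy (\<lambda>z. z) u < \<infinity>"
    using energy_add_finite[OF m _ _ c] int_vec_diff(1)[OF measurable_ident_M _ _ c] by auto
  show "op_diff T (op_of (L q)) u = int_op (\<lambda>z. z - q) u"
  proof (cases "energy (\<lambda>z. z) u < \<infinity>")
    case True
    then show ?thesis
      using fin int_vec_diff(2)[OF measurable_ident_M True _ c]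
      by (simp add: int_op_eq op_diff_def op_add_def op_scaleR_def op_of_def int_vec_const)
  next
    case False
    then show ?thesis
      using fin by (simp add: int_op_eq op_diff_def op_add_def)
  qed
qed

text \<open>Left expanded because \<Delta>_q(T) is defined this way for every q; the factorisation
  is available only for z and q in the half plane.\<close>

definition Delta_fun :: "quat \<Rightarrow> quat \<Rightarrow> quat" where
  "Delta_fun q z = z * z - (2 * qRe q) *\<^sub>R z + (norm q)\<^sup>2 *\<^sub>R 1"

lemma measurable_Delta_fun [measurable]: "Delta_fun q \<in> borel_measurable M"
  unfolding Delta_fun_def[abs_def] by measurable

text \<open>Keeps the domain of \<Delta>_q(T) from growing through cancellation. The linear term is
  absorbed by 2|q||z| \<le> |z|^2/2 + 2|q|^2; moving half of |z|^2 to the left gives the constants 2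
  and 6.\<close>

lemma Delta_fun_growth: "norm (z * z) \<le> 2 * norm (Delta_fun q z) + 6 * (norm q)\<^sup>2"
proof -
  have "norm (z * z) = norm (Delta_fun q z + (2 * qRe q) *\<^sub>R z - (norm q)\<^sup>2 *\<^sub>R 1)"
    by (simp add: Delta_fun_def)
  also have "\<dots> \<le> norm (Delta_fun q z) + 2 * \<bar>qRe q\<bar> * norm z + (norm q)\<^sup>2"
    by (rule order_trans[OF norm_triangle_ineq4]) (auto intro: order_trans[OF norm_triangle_ineq])
  finally have 1: "(norm z)\<^sup>2 \<le> norm (Delta_fun q z) + 2 * \<bar>qRe q\<bar> * norm z + (norm q)\<^sup>2"
    by (simp add: norm_mult power2_eq_square)
  have "2 * \<bar>qRe q\<bar> * norm z \<le> 2 * norm q * norm z"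
    using qRe_le_norm[of q] by (simp add: mult_right_mono)
  moreover have "4 * norm q * norm z \<le> (norm z)\<^sup>2 + 4 * (norm q)\<^sup>2"
    using zero_le_power2[of "norm z - 2 * norm q"]
        by (simp add: power2_diff power_mult_distrib mult_ac)
  ultimately have "(norm z)\<^sup>2 \<le> 2 * norm (Delta_fun q z) + 6 * (norm q)\<^sup>2"
    using 1 by linarith
  then show ?thesis
    by (simp add: norm_mult power2_eq_square)
qed

text \<open>The domains agree because z^2 and the polynomial have finite energy at the same vectors:
  |z| \<le> |z|^2 + 1 controls the linear term, and \<open>Delta_fun_growth\<close> gives the
  converse.\<close>

lemma op_Delta_eq: "op_Delta q T = int_op (Delta_fun q)"
proof
  fix u
  let ?sq = "\<lambda>z::quat. z * z"
  have c: "energy (\<lambda>_. c) u < \<infinity>" for c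
    by (simp add: energy_const)
  have id: "energy (\<lambda>z. z) u < \<infinity>" if "energy ?sq u < \<infinity>"
  proof (rule energy_finite_affine[OF _ _ _ _ _ _ that c[of 1], of _ 1 1])
    fix z :: quat
    have "norm z \<le> 1 * (norm z * norm z) + 1"
      using zero_le_power2[of "norm z - 1/2"] by (simp add: power2_eq_square algebra_simps)
    then show "norm z \<le> 1 * norm (z * z) + 1 * norm (1::quat)"
      by (simp add: norm_mult)
  qed auto
  have sq: "energy ?sq u < \<infinity>" if "energy (Delta_fun q) u < \<infinity>"
    by (rule energy_finite_affine[OF _ _ _ _ _ _ that c[of "of_real ((norm q)\<^sup>2)"], of _ 2 6])
      (use Delta_fun_growth[of _ q] in \<open>auto simp: norm_power\<close>)
  show "op_Delta q T u = int_op (Delta_fun q) u"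
  proof (cases "energy ?sq u < \<infinity>")
    case True
    note fin = id[OF True]
    have lin: "(\<lambda>z. of_real (2 * qRe q) * z) \<in> borel_measurable M"
      "energy (\<lambda>z. of_real (2 * qRe q) * z) u < \<infinity>"
      using energy_bounded_mult_finite[OF bounded_borel_const measurable_ident_M fin] by auto
    have sqm: "?sq \<in> borel_measurable M" by measurable
    note diff = int_vec_diff[OF sqm True lin]
    have diffm: "(\<lambda>z. z * z - of_real (2 * qRe q) * z) \<in> borel_measurable M" by measurable
    have eq: "Delta_fun q = (\<lambda>z. (z * z - of_real (2 * qRe q) * z) + of_real ((norm q)\<^sup>2))"
      by (auto simp: Delta_fun_def scaleR_conv_of_real)
    \<comment> \<open>\<open>L\<close> at a real number is real scaling, so the real coefficients of
      \<Delta>_q(T) can be moved into the integrand.\<close>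
    have Lr: "blinfun_apply (L (of_real r)) v = r *\<^sub>R v" for r v
      by (simp add: of_real_def L_scaleR_1 blinfun.scaleR_left)
    have "int_vec (Delta_fun q) u = int_vec ?sq u - (2 * qRe q) *\<^sub>R int_vec (\<lambda>z. z) u
        + (norm q)\<^sup>2 *\<^sub>R u"
      unfolding eq
      using int_vec_add[OF diffm diff(1) _ c, of "of_real ((norm q)\<^sup>2)"] diff(2)
        int_vec_cmult[OF measurable_ident_M fin, of "of_real (2 * qRe q)"]
        Lr[of "2 * qRe q"] Lr[of "(norm q)\<^sup>2"]
      by (simp add: int_vec_const)
    moreover have "energy (Delta_fun q) u < \<infinity>"
      unfolding eq by (rule energy_add_finite[OF diffm _ diff(1) c]) simp
    moreover have "int_op (\<lambda>z. z) (int_vec (\<lambda>z. z) u) = Some (int_vec ?sq u)"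
      using int_vec_mult[OF measurable_ident_M fin measurable_ident_M True] True
      by (simp add: int_op_eq energy_int_vec[OF measurable_ident_M fin])
    ultimately show ?thesis
      using fin
      by (simp add: op_Delta_def op_diff_def op_add_def op_scaleR_def map_comp_def int_op_eq[of
          _ u])
  next
    case False
    have "(T \<circ>\<^sub>m T) u = None"
    proof (cases "energy (\<lambda>z. z) u < \<infinity>")
      case True
      then show ?thesis
        using False by (simp add: map_comp_def int_op_eq energy_int_vec[OF measurable_ident_M True])
    qed (simp add: map_comp_def int_op_eq)
    then show ?thesis
      using False sq by (auto simp: op_Delta_def op_diff_def op_add_def int_op_eq[of "Delta_fun q"])
  qed
qed

section \<open>Resolvent sets as gaps of the spectral measure\<close>

lemma left_resolvent_set_iff:
  "q \<in> left_resolvent_set L T \<longleftrightarrow> (\<exists>\<epsilon>>0. Q {z\<in>\<Omega>. norm (z - q) < \<epsilon>} = 0)"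
proof -
  let ?f = "\<lambda>z. z - q"
  have f: "?f \<in> borel_measurable M" by measurable
  have dom: "dom T = dom (int_op ?f)"
    unfolding op_diff_L[symmetric] by (auto simp: op_diff_def op_add_def op_of_def op_scaleR_def
        dom_def split: option.splits)
  have iff: "q \<in> left_resolvent_set L T \<longleftrightarrow> bij_betw (\<lambda>u. the (int_op ?f u)) (dom (int_op ?f)) UNIV \<and>
      op_bounded (op_inverse (int_op ?f))"
    by (simp add: left_resolvent_set_def left_resolvent_def op_diff_L dom)
  show ?thesis
  proof
    assume res: "q \<in> left_resolvent_set L T"
    have "op_ker (int_op ?f) = {0}"
    proof -
      have "0 \<in> op_ker (int_op ?f)"
        using f by (simp add: op_ker_def int_op_eq_0_iff)
      moreover have "u = 0" if "u \<in> op_ker (int_op ?f)" for u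
        using res that calculation unfolding iff bij_betw_def inj_on_def op_ker_def
        by (metis (mono_tags, lifting) domI mem_Collect_eq option.sel)
      ultimately show ?thesis by blast
    qed
    then show "\<exists>\<epsilon>>0. Q {z\<in>\<Omega>. norm (z - q) < \<epsilon>} = 0"
      using res f unfolding iff by (simp add: op_ker_int_op op_bounded_inverse_int_op)
  next
    assume gap: "\<exists>\<epsilon>>0. Q {z\<in>\<Omega>. norm (z - q) < \<epsilon>} = 0"
    then obtain \<epsilon> where \<epsilon>: "\<epsilon> > 0" "Q {z\<in>\<Omega>. norm (?f z) < \<epsilon>} = 0" by blast
    note null = Q_zero_of_gap[OF f \<epsilon>]
    \<comment> \<open>A gap bounds 1/f off a null set, so its energy is finite at every vector and
      the range is the whole space.\<close>
    have ran: "ran (int_op ?f) = UNIV"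
      using inverse_bounded_of_gap(1)[OF f \<epsilon>] by (simp add: ran_int_op[OF f null] dom_int_op)
    have "inj_on (\<lambda>u. the (int_op ?f u)) (dom (int_op ?f))"
      by (rule inj_onI) (auto simp: int_op_inverse_iff[OF f null])
    moreover have "(\<lambda>u. the (int_op ?f u)) ` dom (int_op ?f) = UNIV"
      using ran by (force simp: ran_def image_iff)
    ultimately show "q \<in> left_resolvent_set L T"
      unfolding iff bij_betw_def op_bounded_inverse_int_op[OF f null] using gap by blast
  qed
qed

text \<open>\<open>inverse 0 = 0\<close> gives the integrand the prescribed value at z = q.\<close>

lemma left_resolvent_eq:
  assumes "q \<in> left_resolvent_set L T"
  shows "left_resolvent L T q = int_op (\<lambda>z. inverse (z - q))"
proof -
  obtain \<epsilon> where \<epsilon>: "\<epsilon> > 0" "Q {z\<in>\<Omega>. norm (z - q) < \<epsilon>} = 0"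
    using assms left_resolvent_set_iff by blast
  have f: "(\<lambda>z. z - q) \<in> borel_measurable M" by measurable
  show ?thesis
    unfolding left_resolvent_def op_diff_L
    by (rule op_inverse_int_op[OF f Q_zero_of_gap[OF f \<epsilon>]])
qed

text \<open>Both bounds come from the factor |z - \<open>qcnj q\<close>|, which is at least |z - q|
  and at most |z - q| + 2|q|. They turn a gap for one function into a gap for the other.\<close>

lemma norm_Delta_fun:
  assumes "z \<in> \<Omega>" "q \<in> \<Omega>"
  shows "(norm (z - q))\<^sup>2 \<le> norm (Delta_fun q z)"
    "norm (Delta_fun q z) \<le> norm (z - q) * (norm (z - q) + 2 * norm q)"
proof -
  have eq: "norm (Delta_fun q z) = norm (z - q) * norm (z - qcnj q)"
    unfolding Delta_fun_def half_plane_conj_poly(1)[OF imag assms] by (rule norm_mult)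
  show "(norm (z - q))\<^sup>2 \<le> norm (Delta_fun q z)"
    unfolding eq power2_eq_square using half_plane_conj_poly(2)[OF imag assms]
        by (intro mult_left_mono) auto
  have "norm (z - qcnj q) \<le> norm (z - q) + norm (q - qcnj q)"
    using norm_triangle_ineq[of "z - q" "q - qcnj q"] by simp
  moreover have "norm (q - qcnj q) \<le> 2 * norm q"
    using norm_triangle_ineq4[of q "qcnj q"] by simp
  ultimately show "norm (Delta_fun q z) \<le> norm (z - q) * (norm (z - q) + 2 * norm q)"
    unfolding eq by (intro mult_left_mono) auto
qed

lemma Delta_fun_eq_0_iff:
  assumes "z \<in> \<Omega>" "q \<in> \<Omega>"
  shows "Delta_fun q z = 0 \<longleftrightarrow> z = q"
  using norm_Delta_fun[OF assms] by auto

lemma gap_iff: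
  assumes q: "q \<in> \<Omega>"
  shows "(\<exists>\<epsilon>>0. Q {z\<in>\<Omega>. norm (Delta_fun q z) < \<epsilon>} = 0) \<longleftrightarrow> (\<exists>\<epsilon>>0. Q {z\<in>\<Omega>. norm (z - q) < \<epsilon>} = 0)"
proof
  assume "\<exists>\<epsilon>>0. Q {z\<in>\<Omega>. norm (Delta_fun q z) < \<epsilon>} = 0"
  then obtain \<epsilon> where \<epsilon>: "\<epsilon> > 0" "Q {z\<in>\<Omega>. norm (Delta_fun q z) < \<epsilon>} = 0" by blast
  \<comment> \<open>The 1 bounds the second factor of the upper estimate by 1 + 2|q|; the quotient
    then brings the product below \<epsilon>.\<close>
  define \<delta> where "\<delta> = min 1 (\<epsilon> / (1 + 2 * norm q))"
  have "1 + 2 * norm q > 0"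
    by (rule add_pos_nonneg) auto
  then have \<delta>: "\<delta> > 0" "\<delta> \<le> 1" "\<delta> * (1 + 2 * norm q) \<le> \<epsilon>"
    using \<epsilon>(1) by (simp_all add: \<delta>_def flip: pos_le_divide_eq)
  have "Q {z\<in>\<Omega>. norm (z - q) < \<delta>} = 0"
  proof (rule Q_eq_0_subset[OF _ _ _ \<epsilon>(2)])
    have "norm (Delta_fun q z) < \<epsilon>" if "z \<in> \<Omega>" "norm (z - q) < \<delta>" for z
    proof -
      have "norm (Delta_fun q z) \<le> norm (z - q) * (norm (z - q) + 2 * norm q)"
        using norm_Delta_fun(2)[OF that(1) q] .
      also have "\<dots> \<le> norm (z - q) * (1 + 2 * norm q)"
        using that \<delta> by (intro mult_left_mono) auto
      also have "\<dots> < \<delta> * (1 + 2 * norm q)"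
        using that \<open>1 + 2 * norm q > 0\<close> by (intro mult_strict_right_mono) auto
      finally show ?thesis using \<delta>(3) by linarith
    qed
    then show "{z\<in>\<Omega>. norm (z - q) < \<delta>} \<subseteq> {z\<in>\<Omega>. norm (Delta_fun q z) < \<epsilon>}" by blast
  qed measurable
  with \<delta>(1) show "\<exists>\<epsilon>>0. Q {z\<in>\<Omega>. norm (z - q) < \<epsilon>} = 0" by blast
next
  assume "\<exists>\<epsilon>>0. Q {z\<in>\<Omega>. norm (z - q) < \<epsilon>} = 0"
  then obtain \<epsilon> where \<epsilon>: "\<epsilon> > 0" "Q {z\<in>\<Omega>. norm (z - q) < \<epsilon>} = 0" by blast
  \<comment> \<open>The threshold is squared because |z - q|^2 is the lower bound.\<close>
  have "Q {z\<in>\<Omega>. norm (Delta_fun q z) < \<epsilon>\<^sup>2} = 0"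
  proof (rule Q_eq_0_subset[OF _ _ _ \<epsilon>(2)])
    have "norm (z - q) < \<epsilon>" if "z \<in> \<Omega>" "norm (Delta_fun q z) < \<epsilon>\<^sup>2" for z
      using norm_Delta_fun(1)[OF that(1) q] that(2) \<epsilon>(1)
      by (intro power_less_imp_less_base[of "norm (z - q)" 2]) auto
    then show "{z\<in>\<Omega>. norm (Delta_fun q z) < \<epsilon>\<^sup>2} \<subseteq> {z\<in>\<Omega>. norm (z - q) < \<epsilon>}" by blast
  qed measurable
  with \<epsilon>(1) show "\<exists>\<epsilon>>0. Q {z\<in>\<Omega>. norm (Delta_fun q z) < \<epsilon>} = 0"
    by (intro exI[of _ "\<epsilon>\<^sup>2"]) simp
qed

lemma Delta_fun_zero_set: "q \<in> \<Omega> \<Longrightarrow> {z\<in>\<Omega>. Delta_fun q z = 0} = {z\<in>\<Omega>. z - q = 0}"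
  using Delta_fun_eq_0_iff by auto

lemma Q_zero_Delta_of_gap:
  assumes "q \<in> \<Omega>" "\<exists>\<epsilon>>0. Q {z\<in>\<Omega>. norm (z - q) < \<epsilon>} = 0"
  shows "Q {z\<in>\<Omega>. Delta_fun q z = 0} = 0"
  using assms Q_zero_of_gap[of "\<lambda>z. z - q"] by (auto simp: Delta_fun_zero_set)

text \<open>Boundedness of the inverse is a gap for the polynomial, hence for z - q; a gap in turn
  gives a trivial kernel, and that gives a dense range.\<close>

lemma spherical_resolvent_set_iff:
  assumes q: "q \<in> \<Omega>"
  shows "q \<in> spherical_resolvent_set T \<longleftrightarrow> (\<exists>\<epsilon>>0. Q {z\<in>\<Omega>. norm (z - q) < \<epsilon>} = 0)"
  unfolding spherical_resolvent_set_def op_Delta_eq mem_Collect_eq op_ker_int_op[OF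
      measurable_Delta_fun]
  using op_bounded_inverse_int_op[OF measurable_Delta_fun] dense_ran_int_op[OF measurable_Delta_fun]
    gap_iff[OF q] Q_zero_Delta_of_gap[OF q] by blast

lemma continuous_spectra_iff:
  assumes q: "q \<in> \<Omega>"
  shows "q \<in> left_continuous_spectrum L T \<longleftrightarrow> q \<in> spherical_continuous_spectrum T"
proof -
  have f: "(\<lambda>z. z - q) \<in> borel_measurable M" by measurable
  show ?thesis
    unfolding spherical_continuous_spectrum_def left_continuous_spectrum_def left_resolvent_def
      op_diff_L op_Delta_eq mem_Collect_eq
      op_ker_int_op[OF measurable_Delta_fun] op_ker_int_op[OF f] Delta_fun_zero_set[OF q]
    using op_bounded_inverse_int_op[OF measurable_Delta_fun, of q, unfolded
        Delta_fun_zero_set[OF q]]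
      dense_ran_int_op[OF measurable_Delta_fun, of q, unfolded Delta_fun_zero_set[OF q]]
      op_bounded_inverse_int_op[OF f] gap_iff[OF q] by blast
qed

text \<open>A small ball around q misses the closed half plane, so the gap set is empty.\<close>

lemma left_resolvent_set_off_half_plane:
  assumes "q \<notin> \<Omega>"
  shows "q \<in> left_resolvent_set L T"
proof -
  have "open (- \<Omega>)"
    using closed_half_plane[OF imag] by (simp add: open_Compl)
  then obtain \<epsilon> where "\<epsilon> > 0" "ball q \<epsilon> \<subseteq> - \<Omega>"
    using assms openE by blast
  then have "{z\<in>\<Omega>. norm (z - q) < \<epsilon>} = {}"
    by (auto simp: dist_norm norm_minus_commute subset_iff)
  then have "Q {z\<in>\<Omega>. norm (z - q) < \<epsilon>} = 0"
    by (simp only: Q_empty)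
  with \<open>\<epsilon> > 0\<close> show ?thesis
    unfolding left_resolvent_set_iff by blast
qed

lemma left_spectrum_eq: "left_spectrum L T = spherical_spectrum T \<inter> \<Omega>"
  unfolding left_spectrum_def spherical_spectrum_def
  using left_resolvent_set_off_half_plane left_resolvent_set_iff spherical_resolvent_set_iff
      by blast

text \<open>Right linearity gives \<Delta>_q(T)u = u(q^2 - 2 Re(q) q + |q|^2) = 0. As an integral
  this says that \<open>Q\<close> of the set z \<noteq> q annihilates u, which is the kernel
  condition for T - L_q.\<close>

lemma T_eq_L_of_right_eigenvector:
  assumes lin: "qlinear_op T" and q: "q \<in> \<Omega>" and u: "T u = Some (u *\<^sub>Q q)"
  shows "T u = Some (blinfun_apply (L q) u)"
proof -
  have Tq: "T (u *\<^sub>Q q) = Some (u *\<^sub>Q q *\<^sub>Q q)"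
  proof -
    \<comment> \<open>\<open>qlinear_op\<close> speaks of two-term combinations, so a zero term is
      added.\<close>
    have "T (u *\<^sub>Q q + u *\<^sub>Q 0) = Some (u *\<^sub>Q q *\<^sub>Q q + u *\<^sub>Q q *\<^sub>Q 0)"
      using lin u unfolding qlinear_op_def by blast
    then show ?thesis by simp
  qed
  have "op_Delta q T u = Some (u *\<^sub>Q q *\<^sub>Q q + (-1) *\<^sub>R ((2 * qRe q) *\<^sub>R (u *\<^sub>Q q))
      + (norm q)\<^sup>2 *\<^sub>R u)"
    using u Tq by (simp add: op_Delta_def op_diff_def op_add_def op_scaleR_def map_comp_def)
  also have "u *\<^sub>Q q *\<^sub>Q q + (-1) *\<^sub>R ((2 * qRe q) *\<^sub>R (u *\<^sub>Q q)) + (norm q)\<^sup>2 *\<^sub>R u =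
      u *\<^sub>Q (q * q + (-1) *\<^sub>R ((2 * qRe q) *\<^sub>R q) + (norm q)\<^sup>2 *\<^sub>R 1)"
    by (simp add: scaleQ_scaleQ scaleQ_add_right scaleQ_diff_right scaleQ_scaleR_right scaleQ_one)
  also have "q * q + (-1) *\<^sub>R ((2 * qRe q) *\<^sub>R q) + (norm q)\<^sup>2 *\<^sub>R 1 = Delta_fun q q"
    by (simp add: Delta_fun_def)
  also have "\<dots> = 0"
    using Delta_fun_eq_0_iff[OF q q] by simp
  finally have "blinfun_apply (Q {z\<in>\<Omega>. Delta_fun q z \<noteq> 0}) u = 0"
    unfolding op_Delta_eq by (simp add: int_op_eq_0_iff[OF measurable_Delta_fun])
  moreover have "{z\<in>\<Omega>. Delta_fun q z \<noteq> 0} = {z\<in>\<Omega>. z - q \<noteq> 0}"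
    using Delta_fun_eq_0_iff[OF _ q] by auto
  ultimately have "op_diff T (op_of (L q)) u = Some 0"
    unfolding op_diff_L by (subst int_op_eq_0_iff) auto
  then show ?thesis
    using u by (simp add: op_diff_def op_add_def op_of_def op_scaleR_def)
qed

text \<open>A left eigenvalue gives \<open>Q{q} \<noteq> 0\<close>, hence \<open>Q{q} z \<noteq> 0\<close> for some \<open>z\<close> in the basis defining
  \<open>L\<close>; on such vectors \<open>L q\<close> acts as right multiplication by \<open>q\<close>.\<close>
lemma eigenvalue_iff:
  assumes lin: "qlinear_op T" and q: "q \<in> \<Omega>"
  shows "left_eigenvalue L T q \<longleftrightarrow> right_eigenvalue T q"
proof
  have f: "(\<lambda>z. z - q) \<in> borel_measurable M" by measurable
  assume "left_eigenvalue L T q"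
  then have ne: "Q {z\<in>\<Omega>. z - q = 0} \<noteq> 0"
    by (simp add: left_eigenvalue_def op_diff_L op_ker_int_op[OF f])
  let ?E = "{z\<in>\<Omega>. z - q = 0}"
  have E: "?E \<in> sets M" by measurable
  obtain N where N: "hilbert_basis N" "\<And>z q. z \<in> N \<Longrightarrow> blinfun_apply (L q) z = z *\<^sub>Q q"
    using left_scalar_mult_basis[OF left_scalar_mult] by metis
  obtain w where w: "w \<in> N" "blinfun_apply (Q ?E) w \<noteq> 0"
    using blinfun_eq_on_basis[OF N(1) Q_ops[OF E], of 0] ne
    by (auto simp: qbounded_ops_def)
  let ?v = "blinfun_apply (Q ?E) w"
  have "blinfun_apply (Q {z\<in>\<Omega>. z - q \<noteq> 0}) ?v = 0"
    by (rule Q_complement_Q) measurable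
  then have "op_diff T (op_of (L q)) ?v = Some 0"
    unfolding op_diff_L int_op_eq_0_iff[OF f] .
  then have "T ?v = Some (blinfun_apply (L q) ?v)"
    by (auto simp: op_diff_def op_add_def op_of_def op_scaleR_def split: option.splits)
  also have "blinfun_apply (L q) ?v = ?v *\<^sub>Q q"
    using Q_L[OF E, of q w] N(2)[OF w(1)] qbounded_ops_scaleQ[OF Q_ops[OF E]] by simp
  finally show "right_eigenvalue T q"
    using w(2) unfolding right_eigenvalue_def by blast
next
  assume "right_eigenvalue T q"
  then obtain u where u: "u \<noteq> 0" "T u = Some (u *\<^sub>Q q)"
    unfolding right_eigenvalue_def by blast
  then have "op_diff T (op_of (L q)) u = Some 0"
    using T_eq_L_of_right_eigenvector[OF lin q u(2)]
    by (simp add: op_diff_def op_add_def op_of_def op_scaleR_def)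
  with u(1) show "left_eigenvalue L T q"
    by (auto simp: left_eigenvalue_def op_ker_def)
qed

end

theorem theoremE:
  fixes \<iota> :: quat
    and T :: "'h::quat_hilbert qop"
    and Q :: "quat set \<Rightarrow> 'h \<Rightarrow>\<^sub>L 'h"
    and L :: "quat \<Rightarrow> 'h \<Rightarrow>\<^sub>L 'h"
  assumes "\<iota> \<in> imag_units"
    and "qlinear_op T" and "op_closed T" and "op_normal T" and "densely_defined T"
    and "iqpvm \<iota> Q L"
    and "T = iq_integral \<iota> Q L (\<lambda>z. z)"
  shows "left_spectrum L T = spherical_spectrum T \<inter> half_plane \<iota> \<and>
    (\<forall>q\<in>left_resolvent_set L T.
       left_resolvent L T q = iq_integral \<iota> Q L (\<lambda>z. inverse (z - q))) \<and>
    (\<forall>q\<in>half_plane \<iota>.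
       (left_eigenvalue L T q \<longleftrightarrow> right_eigenvalue T q) \<and>
       (\<forall>u\<in>dom T - {0}. T u = Some (u *\<^sub>Q q) \<longrightarrow> T u = Some (blinfun_apply (L q) u)) \<and>
       (op_ker (op_diff T (op_of (L q))) = {0} \<longrightarrow>
          closure (ran (op_diff T (op_of (L q)))) = UNIV) \<and>
       (q \<in> left_continuous_spectrum L T \<longleftrightarrow> q \<in> spherical_continuous_spectrum T))"
proof -
  interpret S: iqpvm_space \<iota> Q L
    using assms by unfold_locales
  note T = assms(7)
  note lin = assms(2)[unfolded T]
  show ?thesis
    unfolding T
  proof (intro conjI ballI impI)
    show "left_spectrum L S.T = spherical_spectrum S.T \<inter> half_plane \<iota>"
      by (rule S.left_spectrum_eq)
  next
    fix q assume "q \<in> left_resolvent_set L S.T"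
    then show "left_resolvent L S.T q = S.int_op (\<lambda>z. inverse (z - q))"
      by (rule S.left_resolvent_eq)
  next
    fix q assume q: "q \<in> half_plane \<iota>"
    show "left_eigenvalue L S.T q \<longleftrightarrow> right_eigenvalue S.T q"
      by (rule S.eigenvalue_iff[OF lin q])
    show "S.T u = Some (blinfun_apply (L q) u)" if "S.T u = Some (u *\<^sub>Q q)" for u
      by (rule S.T_eq_L_of_right_eigenvector[OF lin q that])
    have f: "(\<lambda>z. z - q) \<in> borel_measurable S.M" by measurable
    show "closure (ran (op_diff S.T (op_of (L q)))) = UNIV"
      if "op_ker (op_diff S.T (op_of (L q))) = {0}"
      using that S.dense_ran_int_op[OF f] by (simp add: S.op_diff_L S.op_ker_int_op[OF f])
    show "q \<in> left_continuous_spectrum L S.T \<longleftrightarrow> q \<in> spherical_continuous_spectrum S.T"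
      by (rule S.continuous_spectra_iff[OF q])
  qed
qed

end
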